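(* Let $G$ be a connected graph with at least two edges. Then the line graph $L(G)$ is Hoffman colorable if and only if one of the following statements holds. (i) $G$ is 1-factorable; (ii) $G\cong K_{1,m}$ for some $m$; (iii) $G$ is a path graph; (iv) $G\cong K_3$; (v) $G$ is the graph on six vertices obtained from a triangle by attaching one pendant vertex (leaf) to each of its three vertices.
   Context: All graphs are finite, simple and undirected. $\lambda_{\max}(G)$ and $\lambda_{\min}(G)$ denote the largest and smallest eigenvalues of the adjacency matrix of $G$; $\chi(G)$ is the chromatic number. The line graph $L(G)$ has vertex set $E(G)$, two distinct edges of $G$ being adjacent in $L(G)$ if they share a vertex. A connected graph $G$ with at least one edge is called Hoffman colorable if $\chi(G)=1-\lambda_{\max}(G)/\lambda_{\min}(G)$ (without rounding). A 1-factor (perfect matching) of a graph is a set of edges such that every vertex lies on exactly one of them; a graph is 1-factorable if its edge set can be partitioned into 1-factors. *)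

theory Defs
  imports
    "Graph_Theory.Graph_Theory"
    "Jordan_Normal_Form.Char_Poly"
    "HOL-Library.Disjoint_Sets"
begin

text \<open>
  Finite simple undirected graphs are \<^locale>\<open>pair_graph\<close>s: finite, loop-free digraphs without
  parallel arcs whose arc relation is symmetric. An undirected edge is thus a pair of opposite
  arcs, and it is represented below by the two-element set of its endpoints.
\<close>

definition edge_set :: "'a pair_pre_digraph \<Rightarrow> 'a set set" where
  "edge_set G = {{u, v} | u v. (u, v) \<in> parcs G}"

definition line_graph :: "'a pair_pre_digraph \<Rightarrow> 'a set pair_pre_digraph" where
  "line_graph G = \<lparr>pverts = edge_set G,
     parcs = {(e, f). e \<in> edge_set G \<and> f \<in> edge_set G \<and> e \<noteq> f \<and> e \<inter> f \<noteq> {}}\<rparr>"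

definition adjacency_matrix :: "'a pair_pre_digraph \<Rightarrow> 'a list \<Rightarrow> real mat" where
  "adjacency_matrix G vs = mat (length vs) (length vs)
     (\<lambda>(i, j). if (vs ! i, vs ! j) \<in> parcs G then 1 else 0)"

text \<open>
  Different enumerations \<open>vs\<close> of the vertices give adjacency matrices that are similar via a
  permutation matrix, so the existential quantifier does not add eigenvalues. Adjacency matrices
  are symmetric, hence their real eigenvalues are all their eigenvalues.
\<close>

definition graph_spectrum :: "'a pair_pre_digraph \<Rightarrow> real set" where
  "graph_spectrum G =
     {k. \<exists>vs. distinct vs \<and> set vs = pverts G \<and> eigenvalue (adjacency_matrix G vs) k}"

definition lambda_max :: "'a pair_pre_digraph \<Rightarrow> real" where
  "lambda_max G = Max (graph_spectrum G)"

definition lambda_min :: "'a pair_pre_digraph \<Rightarrow> real" where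
  "lambda_min G = Min (graph_spectrum G)"

definition proper_coloring :: "'a pair_pre_digraph \<Rightarrow> nat \<Rightarrow> ('a \<Rightarrow> nat) \<Rightarrow> bool" where
  "proper_coloring G k c \<longleftrightarrow> (\<forall>v \<in> pverts G. c v < k) \<and> (\<forall>(u, v) \<in> parcs G. c u \<noteq> c v)"

definition chromatic_number :: "'a pair_pre_digraph \<Rightarrow> nat" where
  "chromatic_number G = (LEAST k. \<exists>c. proper_coloring G k c)"

text \<open>
  The constant \<open>Digraph_Component.connected\<close> is qualified to keep it apart from topological
  connectedness. It excludes the graph without vertices.
\<close>

definition hoffman_colorable :: "'a pair_pre_digraph \<Rightarrow> bool" where
  "hoffman_colorable G \<longleftrightarrow> pair_graph G \<and> Digraph_Component.connected (with_proj G) \<and>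
     edge_set G \<noteq> {} \<and> real (chromatic_number G) = 1 - lambda_max G / lambda_min G"

definition one_factor :: "'a pair_pre_digraph \<Rightarrow> 'a set set \<Rightarrow> bool" where
  "one_factor G M \<longleftrightarrow> M \<subseteq> edge_set G \<and> (\<forall>v \<in> pverts G. \<exists>!e. e \<in> M \<and> v \<in> e)"

definition one_factorable :: "'a pair_pre_digraph \<Rightarrow> bool" where
  "one_factorable G \<longleftrightarrow> (\<exists>P. partition_on (edge_set G) P \<and> (\<forall>M \<in> P. one_factor G M))"

definition path_graph :: "nat \<Rightarrow> nat pair_pre_digraph" where
  "path_graph n = \<lparr>pverts = {..<n}, parcs = {(i, j). i < n \<and> j < n \<and> (j = Suc i \<or> i = Suc j)}\<rparr>"

text \<open>The triangle on 0, 1, 2 with the leaves 3, 4, 5 attached.\<close>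

definition net_graph :: "nat pair_pre_digraph" where
  "net_graph = (let A = {(0, 1), (1, 2), (2, 0), (0, 3), (1, 4), (2, 5)}
     in \<lparr>pverts = {..<6}, parcs = A \<union> A\<inverse>\<rparr>)"

end

theory Submission
  imports Defs "HOL-Analysis.Function_Topology"
begin

text \<open>
  Let \<open>A\<close> be the adjacency matrix of the line graph, \<open>x\<close> its Perron vector, \<open>\<theta> = - \<lambda>\<^sub>m\<^sub>i\<^sub>n\<close>, and
  suppose that \<open>k\<close> colors attain the Hoffman bound. Equality in that bound forces, for an edge \<open>uv\<close>
  and any other color \<open>j\<close>, that the edges of color \<open>j\<close> at \<open>u\<close> and at \<open>v\<close> have total weight
  \<open>\<theta> x\<^sub>u\<^sub>v\<close>. Since \<open>A + \<theta> I\<close> is semidefinite, there is a similar balance condition at each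
  component of the subgraph formed by two colors. Here \<open>1 \<le> \<theta> \<le> 2\<close>. If \<open>\<theta> = 2\<close>, then every vertex
  meets every color and the color classes are 1-factors. If \<open>\<theta> = 1\<close>, then the line graph has no
  induced path on three vertices, so it is complete, and \<open>G\<close> is a star or a triangle. If
  \<open>1 < \<theta> < 2\<close>, then the balance conditions and a quadratic invariant of the two-colored components
  show that every vertex is a leaf or meets every color. If there is a leaf and \<open>k \<ge> 3\<close>, then they
  also give \<open>\<theta>\<^sup>2 = \<theta> + 1\<close>, and the leaves propagate along the edges until the net closes up; for
  \<open>k = 2\<close> the graph is a path.

  Conversely, the largest eigenvalue is read off a positive eigenvector. The smallest one is \<open>-2\<close>
  for 1-factorable graphs, with the difference of two 1-factors as eigenvector, and \<open>- \<lambda>\<^sub>m\<^sub>a\<^sub>x\<close> for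
  paths, whose line graphs are bipartite.
\<close>

subsection \<open>Real quadratic forms\<close>

definition quad_form :: "'b set \<Rightarrow> ('b \<Rightarrow> 'b \<Rightarrow> real) \<Rightarrow> ('b \<Rightarrow> real) \<Rightarrow> real" where
  "quad_form V a z = (\<Sum>u\<in>V. z u * (\<Sum>v\<in>V. a u v * z v))"

lemma quad_form_add:
  fixes a :: "'b \<Rightarrow> 'b \<Rightarrow> real"
  assumes sym: "\<And>u v. u \<in> V \<Longrightarrow> v \<in> V \<Longrightarrow> a u v = a v u"
  shows "quad_form V a (\<lambda>v. z v + t * y v) =
    quad_form V a z + 2 * t * (\<Sum>u\<in>V. y u * (\<Sum>v\<in>V. a u v * z v)) + t\<^sup>2 * quad_form V a y"
proof -
  define P where "P = (\<lambda>u. \<Sum>v\<in>V. a u v * z v)"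
  define Q where "Q = (\<lambda>u. \<Sum>v\<in>V. a u v * y v)"
  have PQ: "(\<Sum>v\<in>V. a u v * (z v + t * y v)) = P u + t * Q u" for u
    by (simp add: P_def Q_def distrib_left sum.distrib sum_distrib_left mult.left_commute)
  have "(\<Sum>u\<in>V. z u * Q u) = (\<Sum>u\<in>V. \<Sum>v\<in>V. z u * (a u v * y v))"
    by (simp add: Q_def sum_distrib_left)
  also have "\<dots> = (\<Sum>v\<in>V. \<Sum>u\<in>V. z u * (a u v * y v))"
    by (rule sum.swap)
  also have "\<dots> = (\<Sum>u\<in>V. y u * P u)"
    unfolding P_def sum_distrib_left using sym by (intro sum.cong refl) simp
  finally have "(\<Sum>u\<in>V. z u * Q u) = (\<Sum>u\<in>V. y u * P u)" .
  moreover have "quad_form V a (\<lambda>v. z v + t * y v) =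
      (\<Sum>u\<in>V. z u * P u) + t * (\<Sum>u\<in>V. z u * Q u) + t * (\<Sum>u\<in>V. y u * P u) + t\<^sup>2 * (\<Sum>u\<in>V. y u * Q u)"
    unfolding quad_form_def PQ sum_distrib_left sum.distrib[symmetric]
    by (intro sum.cong refl) (simp add: algebra_simps power2_eq_square)
  ultimately show ?thesis by (simp add: quad_form_def P_def Q_def)
qed

text \<open>A zero of a semidefinite form is a minimum, so its gradient, twice \<open>d\<close>,
  vanishes. Otherwise moving from \<open>z\<close> a little along \<open>- d\<close> would make the
  form negative.\<close>

lemma psd_zero_form_imp_kernel:
  fixes a :: "'b \<Rightarrow> 'b \<Rightarrow> real"
  assumes "finite V" "w \<in> V" and sym: "\<And>u v. u \<in> V \<Longrightarrow> v \<in> V \<Longrightarrow> a u v = a v u"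
    and psd: "\<And>y. quad_form V a y \<ge> 0" and z: "quad_form V a z = 0"
  shows "(\<Sum>v\<in>V. a w v * z v) = 0"
proof -
  define d where "d = (\<lambda>u. \<Sum>v\<in>V. a u v * z v)"
  define s where "s = (\<Sum>u\<in>V. (d u)\<^sup>2)"
  define c where "c = quad_form V a d"
  have q: "0 \<le> 2 * t * s + t\<^sup>2 * c" for t
    using psd[of "\<lambda>v. z v + t * d v"] quad_form_add[of V a z t d, OF sym] z
    by (simp add: s_def c_def d_def power2_eq_square)
  have "c \<ge> 0" unfolding c_def by (rule psd)
  \<comment> \<open>The 1 keeps the denominator positive even if \<open>c = 0\<close>; at this
    \<open>t\<close> the lower bound \<open>q\<close> reads
    \<open>0 \<le> - s\<^sup>2 * (c + 2) / (c + 1)\<^sup>2\<close>.\<close>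
  define t where "t = - s / (c + 1)"
  have t: "t * (c + 1) = - s" using \<open>c \<ge> 0\<close> by (simp add: t_def)
  have "0 \<le> (2 * t * s + t\<^sup>2 * c) * (c + 1)\<^sup>2" using q by simp
  also have "\<dots> = 2 * (t * (c + 1)) * s * (c + 1) + (t * (c + 1))\<^sup>2 * c"
    by (simp add: algebra_simps power2_eq_square)
  also have "\<dots> = - (s\<^sup>2 * (c + 2))" unfolding t by (simp add: algebra_simps power2_eq_square)
  finally have "s\<^sup>2 * (c + 2) \<le> 0" by simp
  then have "s\<^sup>2 \<le> 0" using \<open>c \<ge> 0\<close> by (simp add: mult_le_0_iff)
  then have "\<forall>u\<in>V. (d u)\<^sup>2 = 0"
    using assms(1) by (subst sum_nonneg_eq_0_iff[symmetric]) (simp_all add: s_def)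
  then show ?thesis using assms(2) by (simp add: d_def)
qed

lemma quad_form_shift:
  assumes "finite V"
  shows "quad_form V (\<lambda>u v. a u v + (if u = v then m else 0)) z = quad_form V a z + m * (\<Sum>v\<in>V. (z v)\<^sup>2)"
proof -
  have "(\<Sum>v\<in>V. (a u v + (if u = v then m else 0)) * z v) = (\<Sum>v\<in>V. a u v * z v) + m * z u" if "u \<in> V" for u
    using assms that by (simp add: distrib_right sum.distrib if_distrib[of "\<lambda>x. x * _"] cong: if_cong)
  then show ?thesis
    by (simp add: quad_form_def distrib_left sum.distrib sum_distrib_left power2_eq_square mult.left_commute)
qed

lemma sum_shift:
  fixes a :: "'b \<Rightarrow> 'b \<Rightarrow> real"
  assumes "finite V" "w \<in> V"
  shows "(\<Sum>v\<in>V. (a w v + (if w = v then m else 0)) * z v) = (\<Sum>v\<in>V. a w v * z v) + m * z w" 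
    using assms by (simp add: distrib_right sum.distrib if_distrib[of "\<lambda>x. x * _"] cong: if_cong)

text \<open>Compactness gives a minimizer \<open>z\<close> of the form on the unit sphere, with
  minimum \<open>m\<close>. Then \<open>a - m I\<close> is semidefinite and its form vanishes at
  \<open>z\<close>, so \<open>z\<close> lies in its kernel.\<close>

lemma minimal_eigenvector_exists:
  fixes a :: "'b \<Rightarrow> 'b \<Rightarrow> real"
  assumes "finite V" "V \<noteq> {}" and sym: "\<And>u v. u \<in> V \<Longrightarrow> v \<in> V \<Longrightarrow> a u v = a v u"
  shows "\<exists>m z. (\<exists>v\<in>V. z v \<noteq> 0) \<and> (\<forall>u\<in>V. (\<Sum>v\<in>V. a u v * z v) = m * z u) \<and>
    (\<forall>y. m * (\<Sum>v\<in>V. (y v)\<^sup>2) \<le> quad_form V a y)"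
proof -
  \<comment> \<open>Coordinates outside \<open>V\<close> are pinned to 0. This makes
    \<open>K\<close> a product of compact sets over the whole type, hence compact even if the type
    is infinite.\<close>
  define K where "K = (PiE UNIV (\<lambda>i. if i \<in> V then {-1..1::real} else {0}))"
  define S where "S = K \<inter> {z. (\<Sum>v\<in>V. (z v)\<^sup>2) = 1}"
  have c: "continuous_on A (\<lambda>x::'b \<Rightarrow> real. x i)" for i A
    by (rule continuous_on_subset[OF continuous_on_product_coordinates subset_UNIV])
  have "compactin (product_topology (\<lambda>_. euclidean) UNIV) K"
    unfolding K_def by (subst compactin_PiE) auto
  then have "compact K" by (simp add: euclidean_product_topology)
  moreover have "closed {z :: 'b \<Rightarrow> real. (\<Sum>v\<in>V. (z v)\<^sup>2) = 1}"
    by (intro closed_Collect_eq continuous_on_sum continuous_on_power continuous_on_const c)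
  ultimately have "compact S" unfolding S_def by (rule compact_Int_closed)
  obtain w where "w \<in> V" using assms(2) by auto
  have "(\<lambda>v. if v = w then 1 else 0) \<in> S"
    using \<open>w \<in> V\<close> assms(1) by (auto simp: S_def K_def if_distrib[of "\<lambda>x. x\<^sup>2"] cong: if_cong)
  then have "S \<noteq> {}" by auto
  have "continuous_on S (quad_form V a)"
    unfolding quad_form_def by (intro continuous_on_sum continuous_on_mult continuous_on_const c)
  then obtain z where z: "z \<in> S" "\<And>y. y \<in> S \<Longrightarrow> quad_form V a z \<le> quad_form V a y"
    using continuous_attains_inf[OF \<open>compact S\<close> \<open>S \<noteq> {}\<close>] by blast
  define m where "m = quad_form V a z"
  have bound: "m * (\<Sum>v\<in>V. (y v)\<^sup>2) \<le> quad_form V a y" for y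
  proof (cases "\<forall>v\<in>V. y v = 0")
    case True
    then show ?thesis by (simp add: quad_form_def)
  next
    case False
    define n where "n = (\<Sum>v\<in>V. (y v)\<^sup>2)"
    obtain v0 where "v0 \<in> V" "y v0 \<noteq> 0" using False by blast
    then have "n > 0" unfolding n_def using assms(1) by (intro sum_pos2[of V v0]) simp_all
    define y' where "y' = (\<lambda>v. if v \<in> V then y v / sqrt n else 0)"
    have "\<bar>y' v\<bar> \<le> 1" if "v \<in> V" for v
    proof -
      have "(y v)\<^sup>2 \<le> n" unfolding n_def using assms(1) that by (intro member_le_sum) auto
      then have "(y' v)\<^sup>2 \<le> 1" using \<open>n > 0\<close> that by (simp add: y'_def power_divide)
      then show ?thesis by (simp add: abs_square_le_1)
    qed
    then have "y' i \<in> (if i \<in> V then {-1..1} else {0})" for i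
      by (cases "i \<in> V") (force simp: abs_le_iff, simp add: y'_def)
    then have "y' \<in> K" unfolding K_def by (intro PiE_I) simp_all
    moreover have "(\<Sum>v\<in>V. (y' v)\<^sup>2) = (\<Sum>v\<in>V. (y v)\<^sup>2 / n)"
      using \<open>n > 0\<close> by (intro sum.cong) (auto simp: y'_def power_divide)
    then have "(\<Sum>v\<in>V. (y' v)\<^sup>2) = 1"
      using \<open>n > 0\<close> by (simp flip: sum_divide_distrib n_def)
    ultimately have "y' \<in> S" by (simp add: S_def)
    then have "m \<le> quad_form V a y'" using z(2) m_def by simp
    also have "\<dots> = (\<Sum>u\<in>V. y u * (\<Sum>v\<in>V. a u v * y v) / n)"
      unfolding quad_form_def using \<open>n > 0\<close>
      by (intro sum.cong) (auto simp: y'_def simp flip: sum_divide_distrib)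
    also have "\<dots> = quad_form V a y / n"
      by (simp add: quad_form_def flip: sum_divide_distrib)
    finally show ?thesis using \<open>n > 0\<close> by (simp add: field_simps n_def)
  qed
  have n1: "(\<Sum>v\<in>V. (z v)\<^sup>2) = 1" using z(1) by (simp add: S_def)
  have eig: "(\<Sum>v\<in>V. a u v * z v) = m * z u" if "u \<in> V" for u
  proof -
    let ?b = "\<lambda>u v. a u v + (if u = v then - m else 0)"
    have "(\<Sum>v\<in>V. ?b u v * z v) = 0"
    proof (rule psd_zero_form_imp_kernel[where a = ?b, OF assms(1) that])
      show "?b u v = ?b v u" if "u \<in> V" "v \<in> V" for u v using sym that by auto
      show "0 \<le> quad_form V ?b y" for y
        using bound[of y] unfolding quad_form_shift[OF assms(1), of a] by simp
      show "quad_form V ?b z = 0"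
        unfolding quad_form_shift[OF assms(1), of a] n1 by (simp add: m_def)
    qed
    then show ?thesis using sum_shift[OF assms(1) that, of a "- m" z] by linarith
  qed
  have "\<exists>v\<in>V. z v \<noteq> 0"
  proof (rule ccontr)
    assume "\<not> ?thesis"
    then show False using n1 by simp
  qed
  then show ?thesis using eig bound by (intro exI[of _ m] exI[of _ z]) simp
qed

subsection \<open>Extreme eigenvalues of a graph\<close>

definition adj :: "'b pair_pre_digraph \<Rightarrow> 'b \<Rightarrow> 'b \<Rightarrow> real" where
  "adj H u v = (if (u, v) \<in> parcs H then 1 else 0)"

text \<open>Vectors are functions on the vertices, so that no enumeration has to be chosen; values
  outside \<open>pverts H\<close> do not matter.\<close>

definition eigenpair :: "'b pair_pre_digraph \<Rightarrow> real \<Rightarrow> ('b \<Rightarrow> real) \<Rightarrow> bool" where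
  "eigenpair H k z \<longleftrightarrow> (\<exists>v\<in>pverts H. z v \<noteq> 0) \<and>
     (\<forall>u\<in>pverts H. (\<Sum>v\<in>pverts H. adj H u v * z v) = k * z u)"

lemma adjacency_matrix_mult_vec_nth:
  assumes "distinct vs" "set vs = pverts H" "x \<in> carrier_vec (length vs)" "i < length vs"
    and z: "\<And>j. j < length vs \<Longrightarrow> z (vs ! j) = x $ j"
  shows "(adjacency_matrix H vs *\<^sub>v x) $ i = (\<Sum>v\<in>pverts H. adj H (vs ! i) v * z v)"
proof -
  have "(adjacency_matrix H vs *\<^sub>v x) $ i = (\<Sum>j<length vs. adj H (vs ! i) (vs ! j) * z (vs ! j))"
    using assms(3,4) z
    by (auto simp: adjacency_matrix_def scalar_prod_def adj_def lessThan_atLeast0 intro!: sum.cong)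
  also have "\<dots> = (\<Sum>v\<in>set vs. adj H (vs ! i) v * z v)"
    using bij_betw_nth[OF assms(1) refl refl] by (rule sum.reindex_bij_betw)
  finally show ?thesis by (simp add: assms(2))
qed

text \<open>Entries are carried along the enumeration. The right-hand side does not mention
  \<open>vs\<close>, so all enumerations give the same eigenvalues.\<close>

lemma eigenvalue_adjacency_matrix_iff:
  assumes "distinct vs" "set vs = pverts H"
  shows "eigenvalue (adjacency_matrix H vs) k \<longleftrightarrow> (\<exists>z. eigenpair H k z)"
proof
  let ?n = "length vs"
  have dim: "dim_row (adjacency_matrix H vs) = ?n" by (simp add: adjacency_matrix_def)
  {
    assume "eigenvalue (adjacency_matrix H vs) k"
    then obtain x where x: "x \<in> carrier_vec ?n" "x \<noteq> 0\<^sub>v ?n" "adjacency_matrix H vs *\<^sub>v x = k \<cdot>\<^sub>v x"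
      by (auto simp: eigenvalue_def eigenvector_def dim)
    define z where "z = (\<lambda>v. x $ inv_into {..<?n} ((!) vs) v)"
    have z: "z (vs ! j) = x $ j" if "j < ?n" for j
      using bij_betw_nth[OF assms(1) refl refl] that by (simp add: z_def bij_betw_def)
    have "\<exists>i<?n. x $ i \<noteq> 0"
    proof (rule ccontr)
      assume "\<not> ?thesis"
      then have "x = 0\<^sub>v ?n" using x(1) by (intro eq_vecI) auto
      then show False using x(2) by simp
    qed
    then have "\<exists>v\<in>pverts H. z v \<noteq> 0" using z assms(2) by (metis nth_mem)
    moreover have "(\<Sum>v\<in>pverts H. adj H u v * z v) = k * z u" if "u \<in> pverts H" for u
    proof -
      obtain i where i: "i < ?n" "vs ! i = u" using \<open>u \<in> pverts H\<close> assms(2) by (metis in_set_conv_nth)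
      have "(\<Sum>v\<in>pverts H. adj H u v * z v) = (adjacency_matrix H vs *\<^sub>v x) $ i"
        using adjacency_matrix_mult_vec_nth[OF assms x(1) i(1), of z] z i(2) by simp
      then show ?thesis using x(1,3) z[OF i(1)] i by simp
    qed
    ultimately show "\<exists>z. eigenpair H k z" by (auto simp: eigenpair_def)
  }
  assume "\<exists>z. eigenpair H k z"
  then obtain z where z: "\<exists>v\<in>pverts H. z v \<noteq> 0"
    "\<And>u. u \<in> pverts H \<Longrightarrow> (\<Sum>v\<in>pverts H. adj H u v * z v) = k * z u"
    by (auto simp: eigenpair_def)
  define x where "x = vec ?n (\<lambda>i. z (vs ! i))"
  have x: "x \<in> carrier_vec ?n" by (simp add: x_def)
  obtain i where "i < ?n" "z (vs ! i) \<noteq> 0" using z(1) assms(2) by (metis in_set_conv_nth)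
  then have "x $ i \<noteq> 0\<^sub>v ?n $ i" by (simp add: x_def)
  then have "x \<noteq> 0\<^sub>v ?n" by metis
  moreover have "adjacency_matrix H vs *\<^sub>v x = k \<cdot>\<^sub>v x"
  proof (rule eq_vecI)
    fix i assume "i < dim_vec (k \<cdot>\<^sub>v x)"
    then have i: "i < ?n" by (simp add: x_def)
    then have "vs ! i \<in> pverts H" using assms(2) by (metis nth_mem)
    then show "(adjacency_matrix H vs *\<^sub>v x) $ i = (k \<cdot>\<^sub>v x) $ i"
      using adjacency_matrix_mult_vec_nth[OF assms x i, of z] z(2) i by (simp add: x_def)
  qed (simp add: x_def dim)
  ultimately show "eigenvalue (adjacency_matrix H vs) k"
    using x by (auto simp: eigenvalue_def eigenvector_def dim)
qed

lemma graph_spectrum_iff: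
  assumes "finite (pverts H)"
  shows "k \<in> graph_spectrum H \<longleftrightarrow> (\<exists>z. eigenpair H k z)"
  using finite_distinct_list[OF assms] eigenvalue_adjacency_matrix_iff[of _ H k]
  unfolding graph_spectrum_def by blast

text \<open>The eigenvalues are the roots of the monic characteristic polynomial of a single
  enumeration. Finiteness gives \<open>Max\<close> and \<open>Min\<close> of the spectrum their
  meaning.\<close>

lemma finite_graph_spectrum:
  assumes "finite (pverts H)"
  shows "finite (graph_spectrum H)"
proof -
  obtain vs where vs: "set vs = pverts H" "distinct vs" using finite_distinct_list[OF assms] by blast
  let ?A = "adjacency_matrix H vs"
  have A: "?A \<in> carrier_mat (length vs) (length vs)" by (simp add: adjacency_matrix_def)
  have "graph_spectrum H = {k. poly (char_poly ?A) k = 0}"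
    using graph_spectrum_iff[OF assms] eigenvalue_adjacency_matrix_iff[OF vs(2,1)]
      eigenvalue_root_char_poly[OF A] by auto
  moreover have "char_poly ?A \<noteq> 0" using degree_monic_char_poly[OF A] by auto
  ultimately show ?thesis by (simp add: poly_roots_finite)
qed

section \<open>Rayleigh quotients and the Perron vector\<close>

lemma quad_form_eigenpair:
  assumes "eigenpair H k z"
  shows "quad_form (pverts H) (adj H) z = k * (\<Sum>v\<in>pverts H. (z v)\<^sup>2)"
  using assms
  by (auto simp: eigenpair_def quad_form_def sum_distrib_left power2_eq_square mult_ac intro!: sum.cong)

lemma sum_squares_pos:
  fixes z :: "'b \<Rightarrow> real"
  assumes "finite V" "v \<in> V" "z v \<noteq> 0"
  shows "(\<Sum>v\<in>V. (z v)\<^sup>2) > 0"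
  using assms by (intro sum_pos2[of V v]) simp_all

lemma lambda_min_eqI:
  assumes "finite (pverts H)" "eigenpair H m z"
    and le: "\<And>k y. eigenpair H k y \<Longrightarrow> m \<le> k"
  shows "lambda_min H = m"
  unfolding lambda_min_def
proof (rule Min_eqI)
  show "finite (graph_spectrum H)" using assms(1) by (rule finite_graph_spectrum)
  show "m \<in> graph_spectrum H" using assms(1,2) graph_spectrum_iff by blast
  show "m \<le> k" if "k \<in> graph_spectrum H" for k
    using that graph_spectrum_iff[OF assms(1)] le by blast
qed

lemma quad_form_bound_imp_eigenvalue_bound:
  assumes "finite (pverts H)" "eigenpair H k y"
    and lb: "\<And>y. m * (\<Sum>v\<in>pverts H. (y v)\<^sup>2) \<le> quad_form (pverts H) (adj H) y"
  shows "m \<le> k"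
proof -
  obtain v where "v \<in> pverts H" "y v \<noteq> 0" using assms(2) by (auto simp: eigenpair_def)
  then have "(\<Sum>v\<in>pverts H. (y v)\<^sup>2) > 0" by (rule sum_squares_pos[OF assms(1)])
  moreover have "m * (\<Sum>v\<in>pverts H. (y v)\<^sup>2) \<le> k * (\<Sum>v\<in>pverts H. (y v)\<^sup>2)"
    using lb[of y] quad_form_eigenpair[OF assms(2)] by simp
  ultimately show "m \<le> k" by simp
qed

text \<open>Let \<open>r\<close> be the largest ratio \<open>\<bar>y v\<bar> / x v\<close>, attained
  at \<open>v\<close>. In the eigenvalue equation for \<open>y\<close> at \<open>v\<close> each
  \<open>\<bar>y u\<bar>\<close> is at most \<open>r * x u\<close>, and the equation for the
  positive \<open>x\<close> adds these bounds up to \<open>m * \<bar>y v\<bar>\<close>.\<close>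

lemma abs_eigenvalue_le:
  assumes "finite (pverts H)"
    and pos: "\<And>v. v \<in> pverts H \<Longrightarrow> x v > 0"
    and eig: "\<And>u. u \<in> pverts H \<Longrightarrow> (\<Sum>v\<in>pverts H. adj H u v * x v) = m * x u"
    and y: "eigenpair H k y"
  shows "\<bar>k\<bar> \<le> m"
proof -
  obtain w where w: "w \<in> pverts H" "y w \<noteq> 0" using y by (auto simp: eigenpair_def)
  define r where "r = Max ((\<lambda>v. \<bar>y v\<bar> / x v) ` pverts H)"
  have "r \<in> (\<lambda>v. \<bar>y v\<bar> / x v) ` pverts H" unfolding r_def using assms(1) w(1) by (intro Max_in) auto
  then obtain v where v: "v \<in> pverts H" "r = \<bar>y v\<bar> / x v" by auto
  have r: "\<bar>y u\<bar> \<le> r * x u" if "u \<in> pverts H" for u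
  proof -
    have "\<bar>y u\<bar> / x u \<le> r" unfolding r_def using assms(1) that by (intro Max_ge) auto
    then show ?thesis using pos[OF that] by (simp add: field_simps)
  qed
  have "0 < r * x w" using r[OF w(1)] w(2) by linarith
  then have "r > 0" using pos[OF w(1)] by (simp add: zero_less_mult_iff)
  have yv: "\<bar>y v\<bar> = r * x v" using v pos[OF v(1)] by simp
  have "k * y v = (\<Sum>u\<in>pverts H. adj H v u * y u)" using y v(1) by (simp add: eigenpair_def)
  then have "\<bar>k\<bar> * \<bar>y v\<bar> = \<bar>\<Sum>u\<in>pverts H. adj H v u * y u\<bar>" by (simp flip: abs_mult)
  also have "\<dots> \<le> (\<Sum>u\<in>pverts H. \<bar>adj H v u * y u\<bar>)" by (rule sum_abs)
  also have "\<dots> \<le> (\<Sum>u\<in>pverts H. r * (adj H v u * x u))"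
    using r by (intro sum_mono) (auto simp: adj_def)
  also have "\<dots> = m * \<bar>y v\<bar>" using eig[OF v(1)] yv by (simp flip: sum_distrib_left)
  finally have "\<bar>k\<bar> * \<bar>y v\<bar> \<le> m * \<bar>y v\<bar>" .
  moreover have "\<bar>y v\<bar> > 0" using yv \<open>r > 0\<close> pos[OF v(1)] by simp
  ultimately show ?thesis by simp
qed

lemma lambda_max_eqI:
  assumes "finite (pverts H)" "pverts H \<noteq> {}"
    and pos: "\<And>v. v \<in> pverts H \<Longrightarrow> x v > 0"
    and eig: "\<And>u. u \<in> pverts H \<Longrightarrow> (\<Sum>v\<in>pverts H. adj H u v * x v) = m * x u"
  shows "lambda_max H = m"
  unfolding lambda_max_def
proof (rule Max_eqI)
  show "finite (graph_spectrum H)" using assms(1) by (rule finite_graph_spectrum)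
  have "eigenpair H m x" unfolding eigenpair_def using assms(2) pos eig by force
  then show "m \<in> graph_spectrum H" using assms(1) graph_spectrum_iff by blast
  fix k assume "k \<in> graph_spectrum H"
  then obtain y where "eigenpair H k y" using assms(1) graph_spectrum_iff by blast
  then have "\<bar>k\<bar> \<le> m" using abs_eigenvalue_le[where x = x, OF assms(1) pos eig] by blast
  then show "k \<le> m" by simp
qed

lemma adj_sym: "sym (parcs H) \<Longrightarrow> adj H u v = adj H v u"
  by (auto simp: adj_def dest: symD)

text \<open>The minimum of the form on the unit sphere is an eigenvalue and bounds all eigenvalues
  from below, so it is \<open>lambda_min\<close>.\<close>

lemma lambda_min_eigenpair:
  assumes fin: "finite (pverts H)" and "pverts H \<noteq> {}" and sym: "sym (parcs H)"
  shows "\<exists>z. eigenpair H (lambda_min H) z"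
    and "lambda_min H * (\<Sum>v\<in>pverts H. (y v)\<^sup>2) \<le> quad_form (pverts H) (adj H) y"
proof -
  obtain m z where z: "\<exists>v\<in>pverts H. z v \<noteq> 0"
    "\<forall>u\<in>pverts H. (\<Sum>v\<in>pverts H. adj H u v * z v) = m * z u"
    "\<forall>y. m * (\<Sum>v\<in>pverts H. (y v)\<^sup>2) \<le> quad_form (pverts H) (adj H) y"
    using minimal_eigenvector_exists[of "pverts H" "adj H", OF fin assms(2) adj_sym[OF sym]] by blast
  then have e: "eigenpair H m z" by (simp add: eigenpair_def)
  have "m \<le> k" if "eigenpair H k y" for k y
    by (rule quad_form_bound_imp_eigenvalue_bound[OF fin that z(3)[rule_format]])
  then have "lambda_min H = m" by (rule lambda_min_eqI[OF fin e])
  then show "\<exists>z. eigenpair H (lambda_min H) z"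
    and "lambda_min H * (\<Sum>v\<in>pverts H. (y v)\<^sup>2) \<le> quad_form (pverts H) (adj H) y"
    using e z(3) by auto
qed

text \<open>Minimize the form of \<open>- A\<close>. As \<open>A\<close> has nonnegative entries,
  the absolute value of a minimizer is again a minimizer, hence an eigenvector. Connectedness,
  stated as the absence of proper closed subsets, makes it strictly positive.\<close>

lemma perron_eigenvector:
  assumes fin: "finite (pverts H)" and "pverts H \<noteq> {}" and sym: "sym (parcs H)"
    and conn: "\<And>S. S \<subseteq> pverts H \<Longrightarrow> S \<noteq> {} \<Longrightarrow>
      (\<And>u v. u \<in> S \<Longrightarrow> v \<in> pverts H \<Longrightarrow> (u, v) \<in> parcs H \<Longrightarrow> v \<in> S) \<Longrightarrow> S = pverts H"
  shows "\<exists>x. (\<forall>v\<in>pverts H. x v > 0) \<and>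
    (\<forall>u\<in>pverts H. (\<Sum>v\<in>pverts H. adj H u v * x v) = lambda_max H * x u)"
proof -
  let ?V = "pverts H" and ?a = "\<lambda>u v. - adj H u v"
  have neg: "quad_form ?V ?a y = - quad_form ?V (adj H) y" for y
    by (simp add: quad_form_def sum_negf)
  have a_sym: "?a u v = ?a v u" for u v using adj_sym[OF sym, of u v] by simp
  obtain m z where z: "\<exists>v\<in>?V. z v \<noteq> 0"
    "\<forall>u\<in>?V. (\<Sum>v\<in>?V. ?a u v * z v) = m * z u"
    "\<forall>y. m * (\<Sum>v\<in>?V. (y v)\<^sup>2) \<le> quad_form ?V ?a y"
    using minimal_eigenvector_exists[of "?V" ?a, OF assms(1,2) a_sym] by blast
  define x where "x = (\<lambda>v. \<bar>z v\<bar>)"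
  let ?b = "\<lambda>u v. ?a u v + (if u = v then - m else 0)"
  have psd: "0 \<le> quad_form ?V ?b y" for y
    using z(3)[THEN spec, of y] quad_form_shift[OF fin, of ?a "- m" y] by simp
  have "quad_form ?V ?a z = m * (\<Sum>v\<in>?V. (z v)\<^sup>2)"
  proof -
    have "quad_form ?V ?a z = (\<Sum>u\<in>?V. z u * (m * z u))"
      unfolding quad_form_def by (intro sum.cong refl arg_cong[of _ _ "(*) _"] z(2)[rule_format])
    then show ?thesis by (simp add: sum_distrib_left power2_eq_square mult.left_commute)
  qed
  moreover have "quad_form ?V (adj H) z \<le> quad_form ?V (adj H) x"
    unfolding quad_form_def sum_distrib_left x_def
  proof (intro sum_mono)
    fix u v
    have "z u * z v \<le> \<bar>z u\<bar> * \<bar>z v\<bar>" by (simp flip: abs_mult)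
    then show "z u * (adj H u v * z v) \<le> \<bar>z u\<bar> * (adj H u v * \<bar>z v\<bar>)" by (simp add: adj_def)
  qed
  ultimately have zero: "quad_form ?V ?b x = 0"
    using psd[of x] quad_form_shift[OF fin, of ?a "- m" x] neg[of x] neg[of z] by (simp add: x_def)
  have "(\<Sum>v\<in>?V. ?b u v * x v) = 0" if "u \<in> ?V" for u
  proof (rule psd_zero_form_imp_kernel[where a = ?b, OF fin that _ psd])
    show "?b u v = ?b v u" for u v using a_sym[of u v] by auto
  qed (rule zero)
  then have eig: "(\<Sum>v\<in>?V. adj H u v * x v) = (- m) * x u" if "u \<in> ?V" for u
    using sum_shift[OF fin that, of ?a "- m" x] that by (simp add: sum_negf)
  \<comment> \<open>A vertex with a neighbor in the support has a positive neighbor sum, which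
    equals \<open>(- m) * x v\<close>, so it lies in the support as well.\<close>
  have "{v \<in> ?V. x v > 0} = ?V"
  proof (rule conn)
    show "{v \<in> ?V. x v > 0} \<noteq> {}" using z(1) by (auto simp: x_def)
    fix u v assume u: "u \<in> {v \<in> ?V. x v > 0}" and v: "v \<in> ?V" and uv: "(u, v) \<in> parcs H"
    have "(v, u) \<in> parcs H" using sym uv by (auto dest: symD)
    then have "0 < adj H v u * x u" using u by (simp add: adj_def)
    also have "\<dots> \<le> (\<Sum>w\<in>?V. adj H v w * x w)"
      using u fin by (intro member_le_sum) (auto simp: adj_def x_def)
    also have "\<dots> = (- m) * x v" using eig v by simp
    finally have "x v \<noteq> 0" by auto
    then show "v \<in> {v \<in> ?V. x v > 0}" using v by (simp add: x_def)
  qed auto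
  then have pos: "x v > 0" if "v \<in> ?V" for v using that by blast
  have "lambda_max H = - m" by (rule lambda_max_eqI[OF assms(1,2) pos eig])
  then show ?thesis using pos eig by (intro exI[of _ x]) simp
qed

subsection \<open>Line graphs\<close>

text \<open>A closed set contains whatever is reachable from it, and the set reachable from a vertex
  is closed. In this form a property holds everywhere once it spreads along arcs.\<close>

lemma connected_iff_no_closed_subset:
  assumes "pair_graph G"
  shows "Digraph_Component.connected (with_proj G) \<longleftrightarrow> pverts G \<noteq> {} \<and>
    (\<forall>S \<subseteq> pverts G. S \<noteq> {} \<longrightarrow> (\<forall>u\<in>S. \<forall>v. (u, v) \<in> parcs G \<longrightarrow> v \<in> S) \<longrightarrow> S = pverts G)"
    (is "?L \<longleftrightarrow> ?R")
proof -
  interpret pair_graph G by fact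
  have "symcl (parcs G) = parcs G" by (auto simp: symcl_def intro: arcs_symmetric)
  then have L: "?L \<longleftrightarrow> pverts G \<noteq> {} \<and>
      (\<forall>u\<in>pverts G. \<forall>v\<in>pverts G. (u, v) \<in> rtrancl_on (pverts G) (parcs G))"
    by (simp add: connected_conv)
  show ?thesis
  proof
    assume ?L
    show ?R
    proof (intro conjI allI impI)
      show "pverts G \<noteq> {}" using \<open>?L\<close> L by simp
      fix S assume S: "S \<subseteq> pverts G" "S \<noteq> {}" "\<forall>u\<in>S. \<forall>v. (u, v) \<in> parcs G \<longrightarrow> v \<in> S"
      obtain u where u: "u \<in> S" using S(2) by blast
      have "v \<in> S" if "v \<in> pverts G" for v
      proof -
        have "(u, v) \<in> rtrancl_on (pverts G) (parcs G)" using \<open>?L\<close> L u S(1) that by (meson subsetD)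
        then show ?thesis using u S(3) by (induct rule: rtrancl_on_induct) auto
      qed
      then show "S = pverts G" using S(1) by blast
    qed
  next
    assume R: ?R
    have "(u, v) \<in> rtrancl_on (pverts G) (parcs G)" if "u \<in> pverts G" "v \<in> pverts G" for u v
    proof -
      let ?S = "{w \<in> pverts G. (u, w) \<in> rtrancl_on (pverts G) (parcs G)}"
      have "\<forall>w\<in>?S. \<forall>v. (w, v) \<in> parcs G \<longrightarrow> v \<in> ?S"
      proof (intro ballI allI impI)
        fix w v assume w: "w \<in> ?S" and wv: "(w, v) \<in> parcs G"
        have v: "v \<in> pverts G" using wv by (rule in_arcsD2)
        then have "(u, v) \<in> rtrancl_on (pverts G) (parcs G)"
          using w wv by (blast intro: rtrancl_on_into_rtrancl_on)
        then show "v \<in> ?S" using v by simp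
      qed
      moreover have "u \<in> ?S" using that by simp
      moreover have "?S \<subseteq> pverts G" "?S \<noteq> {}" using that(1) by auto
      ultimately have "?S = pverts G"
        using R[THEN conjunct2, THEN spec, of ?S] by (elim impE)
      then show ?thesis using that by blast
    qed
    then show ?L using R L by simp
  qed
qed

lemma connectedD_closed:
  assumes "pair_graph G" "Digraph_Component.connected (with_proj G)"
    and "S \<subseteq> pverts G" "s \<in> S" "\<And>u v. u \<in> S \<Longrightarrow> (u, v) \<in> parcs G \<Longrightarrow> v \<in> S"
  shows "S = pverts G"
proof -
  have "\<forall>S \<subseteq> pverts G. S \<noteq> {} \<longrightarrow> (\<forall>u\<in>S. \<forall>v. (u, v) \<in> parcs G \<longrightarrow> v \<in> S) \<longrightarrow> S = pverts G"
    using assms(2) connected_iff_no_closed_subset[OF assms(1)] by simp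
  then show ?thesis using assms(3-5) by (elim allE[of _ S]) auto
qed

lemma line_graph_simps [simp]:
  "pverts (line_graph G) = edge_set G"
  "(e, f) \<in> parcs (line_graph G) \<longleftrightarrow> e \<in> edge_set G \<and> f \<in> edge_set G \<and> e \<noteq> f \<and> e \<inter> f \<noteq> {}"
  by (auto simp: line_graph_def)

text \<open>This is the vector \<open>N z\<close> for the vertex-edge incidence matrix
  \<open>N\<close> of the graph.\<close>

definition vertex_sum :: "'a pair_pre_digraph \<Rightarrow> ('a set \<Rightarrow> real) \<Rightarrow> 'a \<Rightarrow> real" where
  "vertex_sum G z v = (\<Sum>e\<in>{e \<in> edge_set G. v \<in> e}. z e)"

context pair_graph
begin

lemma edge_set_iff: "{u, v} \<in> edge_set G \<longleftrightarrow> (u, v) \<in> parcs G"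
  by (auto simp: edge_set_def doubleton_eq_iff dest: arcs_symmetric)

lemma edgeE:
  assumes "e \<in> edge_set G"
  obtains u v where "e = {u, v}" "u \<noteq> v" "u \<in> pverts G" "v \<in> pverts G"
  using assms by (auto simp: edge_set_def dest: no_loops' in_arcsD1 in_arcsD2)

lemma incident_edgeE:
  assumes "e \<in> edge_set G" "u \<in> e"
  obtains v where "e = {u, v}" "u \<noteq> v" "u \<in> pverts G" "v \<in> pverts G"
proof -
  obtain a b where "e = {a, b}" "a \<noteq> b" "a \<in> pverts G" "b \<in> pverts G"
    using assms(1) by (rule edgeE)
  then have "\<exists>v. e = {u, v} \<and> u \<noteq> v \<and> u \<in> pverts G \<and> v \<in> pverts G"
    using assms(2) by blast
  then show thesis using that by (elim exE conjE)
qed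

lemma edge_subset: "e \<in> edge_set G \<Longrightarrow> e \<subseteq> pverts G"
  by (erule edgeE) auto

lemma finite_edge: "e \<in> edge_set G \<Longrightarrow> finite e"
  by (erule edgeE) auto

lemma finite_edge_set [simp]: "finite (edge_set G)"
proof (rule finite_subset)
  show "edge_set G \<subseteq> Pow (pverts G)" using edge_subset by blast
qed simp

lemma pair_graph_line_graph: "pair_graph (line_graph G)"
proof
  show "finite (parcs (line_graph G))"
    by (rule finite_subset[of _ "edge_set G \<times> edge_set G"]) (auto simp: line_graph_def)
  show "symmetric (with_proj (line_graph G))"
    by (auto simp: symmetric_def line_graph_def intro!: symI)
qed (auto simp: line_graph_def)

text \<open>The vertices covered by a closed set of edges form a closed set of vertices, hence are
  all vertices; so every edge touches the set and belongs to it.\<close>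

lemma connected_line_graph:
  assumes conn: "Digraph_Component.connected (with_proj G)" and "edge_set G \<noteq> {}"
  shows "Digraph_Component.connected (with_proj (line_graph G))"
  unfolding connected_iff_no_closed_subset[OF pair_graph_line_graph] line_graph_simps
proof (intro conjI allI impI)
  fix S assume S: "S \<subseteq> edge_set G" "S \<noteq> {}"
    "\<forall>e\<in>S. \<forall>f. e \<in> edge_set G \<and> f \<in> edge_set G \<and> e \<noteq> f \<and> e \<inter> f \<noteq> {} \<longrightarrow> f \<in> S"
  have closed: "f \<in> S" if "f \<in> edge_set G" "u \<in> f" "u \<in> \<Union>S" for u f
  proof -
    from that(3) obtain e where "e \<in> S" "u \<in> e" by blast
    then show ?thesis using S(1,3) that(1,2) by blast
  qed
  obtain e where "e \<in> S" using S(2) by blast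
  then obtain s where "s \<in> \<Union>S" using S(1) by (metis UnionI edgeE insertI1 subsetD)
  moreover have "\<Union>S \<subseteq> pverts G" using S(1) edge_subset by blast
  moreover have "v \<in> \<Union>S" if "u \<in> \<Union>S" "(u, v) \<in> parcs G" for u v
    using closed[of "{u, v}" u] that by (auto simp: edge_set_iff)
  ultimately have V: "\<Union>S = pverts G" using connectedD_closed[OF pair_graph conn] by metis
  have "f \<in> S" if f: "f \<in> edge_set G" for f
  proof -
    obtain u where "u \<in> f" "u \<in> pverts G" using f by (metis edgeE insertI1)
    then show ?thesis using closed[OF f] V by simp
  qed
  then show "S = edge_set G" using S(1) by blast
qed (use assms(2) in simp)

lemma edge_eqI:
  assumes "e \<in> edge_set G" "f \<in> edge_set G" "u \<in> e" "u \<in> f" "v \<in> e" "v \<in> f" "u \<noteq> v"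
  shows "e = f"
proof -
  obtain a where "e = {u, a}" using assms(1,3) by (rule incident_edgeE)
  moreover obtain b where "f = {u, b}" using assms(2,4) by (rule incident_edgeE)
  ultimately show ?thesis using assms by auto
qed

text \<open>In matrix terms \<open>A = N^T N - 2 I\<close>: summing over both ends of
  \<open>e\<close> counts each adjacent edge once, because the graph is simple, and \<open>e\<close>
  itself twice.\<close>

lemma sum_adj_line_graph:
  assumes "e \<in> edge_set G"
  shows "(\<Sum>f\<in>edge_set G. adj (line_graph G) e f * z f) = (\<Sum>v\<in>e. vertex_sum G z v) - 2 * z e"
proof -
  obtain u v where e: "e = {u, v}" "u \<noteq> v" using assms by (rule edgeE)
  have "(\<Sum>f\<in>edge_set G. adj (line_graph G) e f * z f) + 2 * z e =
      (\<Sum>f\<in>edge_set G. adj (line_graph G) e f * z f + (if f = e then 2 * z f else 0))"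
    using assms by (simp add: sum.distrib)
  also have "\<dots> = (\<Sum>f\<in>edge_set G. (if u \<in> f then z f else 0) + (if v \<in> f then z f else 0))"
  proof (rule sum.cong)
    fix f assume f: "f \<in> edge_set G"
    show "adj (line_graph G) e f * z f + (if f = e then 2 * z f else 0) =
      (if u \<in> f then z f else 0) + (if v \<in> f then z f else 0)"
    proof (cases "f = e")
      case True
      then show ?thesis using e by (simp add: adj_def)
    next
      case False
      then have "\<not> (u \<in> f \<and> v \<in> f)" using edge_eqI[OF assms f, of u v] e by blast
      moreover have "adj (line_graph G) e f = (if u \<in> f \<or> v \<in> f then 1 else 0)"
        using False assms f e(1) by (simp add: adj_def)
      ultimately show ?thesis using False by auto
    qed
  qed simp
  also have "\<dots> = vertex_sum G z u + vertex_sum G z v"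
    by (simp add: vertex_sum_def sum.distrib flip: sum.inter_filter)
  finally show ?thesis using e by simp
qed

text \<open>The factor \<open>N^T N\<close> turns into the squared norm of \<open>N z\<close> by
  exchanging the sums over edges and over their ends. This is why no eigenvalue is below -2.\<close>

lemma quad_form_line_graph:
  "quad_form (edge_set G) (adj (line_graph G)) z =
    (\<Sum>v\<in>pverts G. (vertex_sum G z v)\<^sup>2) - 2 * (\<Sum>e\<in>edge_set G. (z e)\<^sup>2)"
proof -
  have "(\<Sum>e\<in>edge_set G. \<Sum>v\<in>e. z e * vertex_sum G z v) =
      (\<Sum>e\<in>edge_set G. \<Sum>v\<in>{v \<in> pverts G. v \<in> e}. z e * vertex_sum G z v)"
  proof (rule sum.cong)
    fix e assume "e \<in> edge_set G"
    then have "{v \<in> pverts G. v \<in> e} = e" using edge_subset by blast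
    then show "(\<Sum>v\<in>e. z e * vertex_sum G z v) = (\<Sum>v\<in>{v \<in> pverts G. v \<in> e}. z e * vertex_sum G z v)"
      by simp
  qed simp
  also have "\<dots> = (\<Sum>v\<in>pverts G. \<Sum>e\<in>{e \<in> edge_set G. v \<in> e}. z e * vertex_sum G z v)"
    by (rule sum.swap_restrict) simp_all
  also have "\<dots> = (\<Sum>v\<in>pverts G. (vertex_sum G z v)\<^sup>2)"
    by (simp add: vertex_sum_def power2_eq_square flip: sum_distrib_right)
  finally show ?thesis
    by (simp add: quad_form_def sum_adj_line_graph right_diff_distrib sum_subtractf sum_distrib_left
        power2_eq_square mult.left_commute)
qed

end

text \<open>Giving all vertices different colors shows that the \<open>LEAST\<close> in
  \<open>chromatic_number\<close> is attained.\<close>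

lemma finite_graph_colorable:
  assumes "finite (pverts H)" "\<And>v. (v, v) \<notin> parcs H"
    "\<And>u v. (u, v) \<in> parcs H \<Longrightarrow> u \<in> pverts H \<and> v \<in> pverts H"
  shows "\<exists>k c. proper_coloring H k c"
proof -
  obtain c where c: "bij_betw c (pverts H) {0..<card (pverts H)}"
    using ex_bij_betw_finite_nat[OF assms(1)] by blast
  have "c u \<noteq> c v" if "(u, v) \<in> parcs H" for u v
    using bij_betw_imp_inj_on[OF c, THEN inj_onD, of u v] assms(2,3) that by metis
  moreover have "c v < card (pverts H)" if "v \<in> pverts H" for v
    using bij_betwE[OF c] that by simp
  ultimately have "proper_coloring H (card (pverts H)) c" by (auto simp: proper_coloring_def)
  then show ?thesis by blast
qed

lemma clique_card_le:
  assumes c: "proper_coloring H k c" and "K \<subseteq> pverts H"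
    and K: "\<And>u v. u \<in> K \<Longrightarrow> v \<in> K \<Longrightarrow> u \<noteq> v \<Longrightarrow> (u, v) \<in> parcs H"
  shows "card K \<le> k"
proof -
  have "c u \<noteq> c v" if "(u, v) \<in> parcs H" for u v
    using c that unfolding proper_coloring_def by blast
  then have "inj_on c K" unfolding inj_on_def using K by metis
  moreover have "c ` K \<subseteq> {..<k}" using c assms(2) unfolding proper_coloring_def by blast
  ultimately have "card K \<le> card {..<k}" by (rule card_inj_on_le) simp
  then show ?thesis by simp
qed

subsection \<open>Weights of a Hoffman coloring\<close>

text \<open>Intended for \<open>k\<close> the chromatic number of the line graph and
  \<open>\<theta>\<close> minus its least eigenvalue. Equality in the Hoffman bound then says that
  the Perron eigenvalue is \<open>(k - 1) * \<theta>\<close>, which is \<open>x_eigen\<close>, and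
  \<open>form_bound\<close> says that \<open>A + \<theta> I\<close> is semidefinite.\<close>

locale hoffman_edge_coloring = pair_graph G for G :: "'a pair_pre_digraph" +
  fixes c :: "'a set \<Rightarrow> nat" and x :: "'a set \<Rightarrow> real" and k :: nat and \<theta> :: real
  assumes conn: "Digraph_Component.connected (with_proj G)"
    and two_edges: "2 \<le> card (edge_set G)"
    and coloring: "proper_coloring (line_graph G) k c"
    and x_pos: "\<And>e. e \<in> edge_set G \<Longrightarrow> 0 < x e"
    and x_eigen: "\<And>e. e \<in> edge_set G \<Longrightarrow>
      (\<Sum>f\<in>edge_set G. adj (line_graph G) e f * x f) = (real k - 1) * \<theta> * x e"
    and form_bound: "\<And>z. - \<theta> * (\<Sum>e\<in>edge_set G. (z e)\<^sup>2) \<le> quad_form (edge_set G) (adj (line_graph G)) z"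
    and theta_ge: "1 \<le> \<theta>" and theta_le: "\<theta> \<le> 2"
begin

abbreviation E where "E \<equiv> edge_set G"
abbreviation A where "A \<equiv> adj (line_graph G)"

text \<open>At most one edge at a vertex has color \<open>j\<close>; \<open>weight j v\<close> is its Perron entry, or 0 if there is none.\<close>
definition weight :: "nat \<Rightarrow> 'a \<Rightarrow> real" where
  "weight j = vertex_sum G (\<lambda>e. if c e = j then x e else 0)"

lemma color_less: "e \<in> E \<Longrightarrow> c e < k"
  using coloring by (simp add: proper_coloring_def)

lemma color_inj:
  assumes "e \<in> E" "f \<in> E" "u \<in> e" "u \<in> f" "c e = c f"
  shows "e = f"
proof (rule ccontr)
  assume "e \<noteq> f"
  then have "(e, f) \<in> parcs (line_graph G)" using assms by auto
  then show False using coloring assms(5) unfolding proper_coloring_def by blast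
qed

lemma weight_eq:
  assumes "e \<in> E" "v \<in> e"
  shows "weight (c e) v = x e"
proof -
  have "weight (c e) v = (\<Sum>f\<in>{f \<in> E. v \<in> f}. if f = e then x f else 0)"
    unfolding weight_def vertex_sum_def
  proof (rule sum.cong)
    fix f assume "f \<in> {f \<in> E. v \<in> f}"
    then have "c f = c e \<longleftrightarrow> f = e" using color_inj[of f e v] assms by blast
    then show "(if c f = c e then x f else 0) = (if f = e then x f else 0)" by simp
  qed simp
  also have "\<dots> = x e" using assms by simp
  finally show ?thesis .
qed

lemma weight_eq_0:
  assumes "\<And>e. e \<in> E \<Longrightarrow> v \<in> e \<Longrightarrow> c e \<noteq> j"
  shows "weight j v = 0"
  unfolding weight_def vertex_sum_def by (rule sum.neutral) (use assms in auto)

lemma edge_of_weight: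
  assumes "weight j v \<noteq> 0"
  obtains e where "e \<in> E" "v \<in> e" "c e = j"
  using assms weight_eq_0 by metis

lemma form_zero_imp_kernel:
  assumes "(\<Sum>e\<in>E. z e * ((\<Sum>f\<in>E. A e f * z f) + \<theta> * z e)) = 0" "e \<in> E"
  shows "(\<Sum>f\<in>E. A e f * z f) = - \<theta> * z e"
proof -
  let ?M = "\<lambda>e f. A e f + (if e = f then \<theta> else 0)"
  have A_sym: "A e f = A f e" for e f by (auto simp: adj_def)
  have "(\<Sum>f\<in>E. ?M e f * z f) = 0"
  proof (rule psd_zero_form_imp_kernel[where a = ?M, OF finite_edge_set assms(2)])
    show "?M e f = ?M f e" for e f using A_sym[of e f] by simp
    show "0 \<le> quad_form E ?M y" for y
      using form_bound[of y] unfolding quad_form_shift[OF finite_edge_set, of A] by simp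
    have "quad_form E ?M z = (\<Sum>e\<in>E. z e * ((\<Sum>f\<in>E. A e f * z f) + \<theta> * z e))"
      unfolding quad_form_def by (intro sum.cong refl) (simp add: sum_shift[OF finite_edge_set, of _ A])
    then show "quad_form E ?M z = 0" using assms(1) by simp
  qed
  then show ?thesis using sum_shift[OF finite_edge_set assms(2), of A \<theta> z] by simp
qed

lemma k_pos: "0 < k"
proof -
  have "E \<noteq> {}" using two_edges by force
  then show ?thesis using color_less by fastforce
qed

text \<open>A color class is independent in the line graph: for \<open>e\<close> in the class both
  ends have weight \<open>x e\<close>, which cancels the term \<open>2 * x e\<close> of
  \<open>sum_adj_line_graph\<close>. For other \<open>e\<close> that term is 0.\<close>

lemma sum_adj_color_class:
  assumes "e \<in> E"
  shows "(\<Sum>f\<in>E. A e f * (if c f = j then x f else 0)) = (if c e = j then 0 else (\<Sum>v\<in>e. weight j v))"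
proof -
  obtain u v where e: "e = {u, v}" "u \<noteq> v" using assms by (rule edgeE)
  have "(\<Sum>v\<in>e. weight j v) = 2 * x e" if "c e = j"
    using weight_eq[OF assms, of u] weight_eq[OF assms, of v] that e by simp
  then show ?thesis
    by (simp add: sum_adj_line_graph[OF assms, of "\<lambda>f. if c f = j then x f else 0"] flip: weight_def)
qed

text \<open>
  The vectors \<open>x - k x\<^sub>j\<close>, where \<open>x\<^sub>j\<close> is the restriction of \<open>x\<close> to the color class \<open>j\<close>, lie in
  the kernel of the semidefinite form \<open>A + \<theta> I\<close>, because its values at them add up to 0.
\<close>
lemma weight_sum:
  assumes e: "e \<in> E" "e = {u, v}" and j: "j < k" "c e \<noteq> j"
  shows "weight j u + weight j v = \<theta> * x e"
proof -
  define y where "y = (\<lambda>j f. if c f = j then x f else 0)"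
  define N where "N = (\<lambda>j. \<Sum>f\<in>E. (y j f)\<^sup>2)"
  define S where "S = (\<Sum>f\<in>E. (x f)\<^sup>2)"
  define Q where "Q = (\<lambda>j. quad_form E A (\<lambda>f. x f + (- real k) * y j f)
    + \<theta> * (\<Sum>f\<in>E. (x f + (- real k) * y j f)\<^sup>2))"
  have A_sym: "A e f = A f e" for e f by (auto simp: adj_def)
  have xy: "y j f * x f = (y j f)\<^sup>2" for j f by (simp add: y_def power2_eq_square)
  \<comment> \<open>The form is expanded around \<open>x\<close>: \<open>x_eigen\<close> evaluates
    the pure \<open>x\<close> term and the cross term, and the form of \<open>A\<close> vanishes at
    \<open>y j\<close> because the color class is independent.\<close>
  have Q: "Q j = real k * \<theta> * S - (real k)\<^sup>2 * \<theta> * N j" for j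
  proof -
    have 1: "quad_form E A x = (real k - 1) * \<theta> * S"
      using x_eigen by (simp add: quad_form_def S_def sum_distrib_left power2_eq_square mult.left_commute)
    have 2: "quad_form E A (y j) = 0"
      unfolding quad_form_def y_def by (rule sum.neutral) (simp add: sum_adj_color_class)
    have 3: "(\<Sum>e\<in>E. y j e * (\<Sum>f\<in>E. A e f * x f)) = (real k - 1) * \<theta> * N j"
      using x_eigen by (simp add: N_def sum_distrib_left mult.left_commute flip: xy)
    have 4: "(\<Sum>f\<in>E. (x f + (- real k) * y j f)\<^sup>2) = S - 2 * real k * N j + (real k)\<^sup>2 * N j"
    proof -
      have "(x f + (- real k) * y j f)\<^sup>2 = (x f)\<^sup>2 - 2 * real k * (y j f)\<^sup>2 + (real k)\<^sup>2 * (y j f)\<^sup>2" for f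
        by (simp add: y_def power2_eq_square algebra_simps)
      then show ?thesis by (simp add: N_def S_def sum.distrib sum_subtractf sum_distrib_left)
    qed
    have "quad_form E A (\<lambda>f. x f + (- real k) * y j f) = quad_form E A x
        + 2 * (- real k) * (\<Sum>e\<in>E. y j e * (\<Sum>f\<in>E. A e f * x f)) + (- real k)\<^sup>2 * quad_form E A (y j)"
      by (rule quad_form_add[OF A_sym])
    then show ?thesis unfolding Q_def 1 2 3 4 by (simp add: algebra_simps power2_eq_square)
  qed
  have "(\<Sum>j<k. y j f * y j f) = x f * x f" if "f \<in> E" for f
  proof -
    have "(\<Sum>j<k. y j f * y j f) = (\<Sum>j<k. if c f = j then x f * x f else 0)"
      by (intro sum.cong refl) (simp add: y_def)
    then show ?thesis using color_less[OF that] by simp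
  qed
  \<comment> \<open>The color classes partition the edges, so the \<open>Q j\<close> add up to
    \<open>k * (k \<theta> S) - k\<^sup>2 \<theta> S = 0\<close>; being nonnegative, each of them is
    0.\<close>
  then have "(\<Sum>j<k. N j) = S"
    unfolding N_def S_def by (subst sum.swap) (simp add: power2_eq_square)
  then have "(\<Sum>j<k. Q j) = 0"
    by (simp add: Q sum_subtractf power2_eq_square flip: sum_distrib_left)
  moreover have "0 \<le> Q j" for j
    using form_bound[of "\<lambda>f. x f + (- real k) * y j f"] by (simp add: Q_def)
  ultimately have "Q j = 0" using j(1) by (simp add: sum_nonneg_eq_0_iff)
  define z where "z = (\<lambda>f. x f + (- real k) * y j f)"
  have "(\<Sum>e\<in>E. z e * ((\<Sum>f\<in>E. A e f * z f) + \<theta> * z e)) = Q j"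
    by (simp add: Q_def z_def quad_form_def distrib_left sum.distrib sum_distrib_left power2_eq_square
        mult.left_commute)
  then have "(\<Sum>f\<in>E. A e f * z f) = - \<theta> * z e"
    using \<open>Q j = 0\<close> e(1) by (intro form_zero_imp_kernel) simp_all
  \<comment> \<open>As \<open>e\<close> does not have color \<open>j\<close>, the kernel equation at
    \<open>e\<close> becomes \<open>(k - 1) \<theta> x e - k (weight j u + weight j v) = - \<theta>
    x e\<close>.\<close>
  moreover have "(\<Sum>f\<in>E. A e f * z f) = (real k - 1) * \<theta> * x e - real k * (\<Sum>v\<in>e. weight j v)"
  proof -
    have "(\<Sum>f\<in>E. A e f * z f) = (\<Sum>f\<in>E. A e f * x f) - real k * (\<Sum>f\<in>E. A e f * y j f)"
      by (simp add: z_def algebra_simps sum_subtractf sum_distrib_left)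
    then show ?thesis using x_eigen[OF e(1)] sum_adj_color_class[OF e(1), of j] j(2) by (simp add: y_def)
  qed
  moreover have "z e = x e" using j(2) by (simp add: z_def y_def)
  ultimately have "real k * (\<Sum>v\<in>e. weight j v) = real k * (\<theta> * x e)" by (simp add: algebra_simps)
  then have "(\<Sum>v\<in>e. weight j v) = \<theta> * x e" using k_pos by simp
  moreover have "u \<noteq> v" using e edge_set_iff no_loops' by blast
  ultimately show ?thesis using e(2) by simp
qed

text \<open>
  The weights on the edges of two colors alternating in sign stay in the kernel of \<open>A + \<theta> I\<close> when
  they are restricted to a union of components of the subgraph formed by these edges.
\<close>
lemma kempe_balance:
  assumes closed: "\<And>f. f \<in> E \<Longrightarrow> c f = i \<or> c f = j \<Longrightarrow> f \<inter> U \<noteq> {} \<Longrightarrow> f \<subseteq> U"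
    and ij: "i < k" "j < k" "i \<noteq> j" and e: "e \<in> E" "e = {u, v}" "c e \<noteq> i" "c e \<noteq> j"
  shows "(if u \<in> U then weight i u - weight j u else 0) + (if v \<in> U then weight i v - weight j v else 0) = 0"
proof -
  define z where "z = (\<lambda>f. if f \<inter> U = {} then 0 else if c f = i then x f else if c f = j then - x f else 0)"
  have vs: "vertex_sum G z w = (if w \<in> U then weight i w - weight j w else 0)" for w
  proof (cases "w \<in> U")
    case True
    have "vertex_sum G z w = (\<Sum>f\<in>{f \<in> E. w \<in> f}. (if c f = i then x f else 0) - (if c f = j then x f else 0))"
      unfolding vertex_sum_def by (rule sum.cong) (use True ij(3) in \<open>auto simp: z_def\<close>)
    then show ?thesis using True by (simp add: sum_subtractf weight_def vertex_sum_def)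
  next
    case False
    have "z f = 0" if "f \<in> E" "w \<in> f" for f
      using closed[OF that(1)] that(2) False by (auto simp: z_def)
    then show ?thesis using False by (simp add: vertex_sum_def)
  qed
  have sum: "(\<Sum>f\<in>E. A e f * z f) = vertex_sum G z u + vertex_sum G z v - 2 * z e"
    if "e \<in> E" "e = {u, v}" for e u v
    using sum_adj_line_graph[OF that(1), of z] that edge_set_iff no_loops'[of u v] by auto
  \<comment> \<open>Edges off the support contribute 0 whatever \<open>A z\<close> is there, and on
    the support \<open>weight_sum\<close> gives the eigenvalue equation. So the form vanishes, and
    semidefiniteness yields the equation off the support too; at \<open>e\<close>, where
    \<open>z e = 0\<close>, it is the balance.\<close>
  have "z f * ((\<Sum>h\<in>E. A f h * z h) + \<theta> * z f) = 0" if f: "f \<in> E" for f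
  proof (cases "f \<inter> U \<noteq> {} \<and> (c f = i \<or> c f = j)")
    case False
    then have "z f = 0" by (auto simp: z_def)
    then show ?thesis by simp
  next
    case True
    obtain a b where f': "f = {a, b}" using f by (rule edgeE)
    have U: "a \<in> U" "b \<in> U" using closed[OF f] True f' by auto
    have s: "(\<Sum>h\<in>E. A f h * z h) = weight i a - weight j a + (weight i b - weight j b) - 2 * z f"
      using sum[OF f f'] U by (simp add: vs)
    have w: "weight (c f) a = x f" "weight (c f) b = x f" using weight_eq[OF f] f' by auto
    have "(\<Sum>h\<in>E. A f h * z h) = - \<theta> * z f"
    proof (cases "c f = i")
      case True
      then have "weight j a + weight j b = \<theta> * x f" "z f = x f"
        using weight_sum[OF f f' ij(2)] ij(3) U f' by (auto simp: z_def)
      then show ?thesis using s w True by simp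
    next
      case False
      then have "weight i a + weight i b = \<theta> * x f" "c f = j"
        using weight_sum[OF f f' ij(1)] True by auto
      moreover have "z f = - x f" using False \<open>c f = j\<close> U f' by (auto simp: z_def)
      ultimately show ?thesis using s w by simp
    qed
    then show ?thesis by simp
  qed
  then have "(\<Sum>f\<in>E. A e f * z f) = - \<theta> * z e"
    using e(1) by (intro form_zero_imp_kernel sum.neutral) simp_all
  moreover have "z e = 0" using e(3,4) by (simp add: z_def)
  ultimately show ?thesis using sum[OF e(1,2)] vs by simp
qed

end

subsection \<open>Stars, triangles, paths and the net\<close>

text \<open>Here \<open>p\<close> labels the vertices of \<open>G\<close> by those of the model
  \<open>H\<close>; \<open>digraph_iso\<close> asks for a map out of \<open>G\<close>, hence the
  inverse \<open>q\<close>.\<close>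

lemma digraph_isoI:
  assumes wf: "pair_wf_digraph G" and inj: "inj_on p (pverts H)"
    and V: "pverts G = p ` pverts H" and arcs: "parcs G = map_prod p p ` parcs H"
    and H: "parcs H \<subseteq> pverts H \<times> pverts H"
  shows "digraph_iso (with_proj G) (with_proj H)"
proof -
  interpret pair_wf_digraph G by fact
  define q where "q = the_inv_into (pverts H) p"
  have qp: "q (p i) = i" if "i \<in> pverts H" for i
    using the_inv_into_f_f[OF inj that] by (simp add: q_def)
  have q: "inj_on q (pverts G)" unfolding V by (rule inj_onI) (auto simp: qp)
  define f where "f = \<lparr>iso_verts = q, iso_arcs = map_prod q q, iso_head = snd, iso_tail = fst\<rparr>"
  have "digraph_isomorphism f"
    unfolding digraph_isomorphism_def
  proof (intro conjI)
    show "wf_digraph (with_proj G)" by (rule wf_digraph_axioms)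
    have "inj_on (map_prod q q) (pverts G \<times> pverts G)" by (rule map_prod_inj_on[OF q q])
    then have "inj_on (map_prod q q) (parcs G)"
      by (rule inj_on_subset) (auto intro: in_arcsD1 in_arcsD2)
    then show "inj_on (iso_arcs f) (parcs G)" by (simp add: f_def)
  qed (use q in \<open>simp_all add: f_def\<close>)
  moreover have "with_proj H = app_iso f (with_proj G)"
  proof -
    have "q ` p ` pverts H = pverts H" by (force simp: image_image qp)
    moreover have "map_prod q q (map_prod p p a) = a" if "a \<in> parcs H" for a
      using H that by (cases a) (auto simp: qp)
    then have "map_prod q q ` map_prod p p ` parcs H = parcs H" by (force simp: image_image)
    ultimately show ?thesis by (simp add: with_proj_def app_iso_def f_def V arcs)
  qed
  ultimately show ?thesis by (auto simp: digraph_iso_def)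
qed

lemma digraph_isoD:
  assumes wf: "pair_wf_digraph G" and "digraph_iso (with_proj G) (with_proj H)"
  obtains p where "inj_on p (pverts H)" "pverts G = p ` pverts H" "parcs G = map_prod p p ` parcs H"
proof -
  interpret pair_wf_digraph G by fact
  obtain f where f: "digraph_isomorphism f" "with_proj H = app_iso f (with_proj G)"
    using assms(2) by (auto simp: digraph_iso_def)
  define g where "g = iso_verts f"
  have inj: "inj_on g (pverts G)" using f(1) by (simp add: digraph_isomorphism_def g_def)
  have H: "pverts H = g ` pverts G" "parcs H = iso_arcs f ` parcs G" "iso_tail f = fst" "iso_head f = snd"
    using f(2) by (simp_all add: with_proj_def app_iso_def g_def)
  have "iso_arcs f a = map_prod g g a" if "a \<in> parcs G" for a
    using f(1) that H(3,4) by (auto simp: digraph_isomorphism_def g_def intro!: prod_eqI)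
  then have arcs: "parcs H = map_prod g g ` parcs G" unfolding H(2) by (rule image_cong[OF refl])
  define p where "p = the_inv_into (pverts G) g"
  have pg: "p (g v) = v" if "v \<in> pverts G" for v
    using the_inv_into_f_f[OF inj that] by (simp add: p_def)
  show thesis
  proof (rule that)
    show "inj_on p (pverts H)" unfolding H(1) by (rule inj_onI) (auto simp: pg)
    show "pverts G = p ` pverts H" unfolding H(1) by (force simp: image_image pg)
    have "map_prod p p (map_prod g g a) = a" if "a \<in> parcs G" for a
      using that in_arcsD1 in_arcsD2 by (cases a) (auto simp: pg)
    then show "parcs G = map_prod p p ` parcs H" unfolding arcs by (force simp: image_image)
  qed
qed

lemma edge_set_image:
  assumes "parcs G = map_prod p p ` parcs H"
  shows "edge_set G = (`) p ` edge_set H"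
proof -
  have e: "edge_set K = (\<lambda>(u, v). {u, v}) ` parcs K" for K :: "'c pair_pre_digraph"
    by (auto simp: edge_set_def)
  have "(\<lambda>(u, v). {u, v}) ` map_prod p p ` parcs H = (`) p ` (\<lambda>(u, v). {u, v}) ` parcs H"
    unfolding image_image by (rule image_cong) auto
  then show ?thesis using e[of G] e[of H] assms by simp
qed

context pair_graph
begin

text \<open>Connectedness of the line graph, in the form that spreads a property from one edge to
  all edges.\<close>

lemma line_closedD:
  assumes conn: "Digraph_Component.connected (with_proj G)" and "S \<subseteq> edge_set G" "e \<in> S"
    and closed: "\<And>e f. e \<in> S \<Longrightarrow> f \<in> edge_set G \<Longrightarrow> e \<inter> f \<noteq> {} \<Longrightarrow> f \<in> S"
  shows "S = edge_set G"
proof -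
  have "edge_set G \<noteq> {}" using assms(2,3) by blast
  note L = pair_graph_line_graph connected_line_graph[OF conn this]
  have "S = pverts (line_graph G)"
  proof (rule connectedD_closed[OF L])
    show "f \<in> S" if "e \<in> S" "(e, f) \<in> parcs (line_graph G)" for e f
      using closed[of e f] that by simp
  qed (use assms in simp_all)
  then show ?thesis by simp
qed

lemma vertex_has_edge:
  assumes conn: "Digraph_Component.connected (with_proj G)" and "edge_set G \<noteq> {}" "v \<in> pverts G"
  shows "\<exists>e\<in>edge_set G. v \<in> e"
proof (rule ccontr)
  assume no: "\<not> ?thesis"
  have "{v} = pverts G"
  proof (rule connectedD_closed[OF pair_graph conn])
    fix u w assume "u \<in> {v}" "(u, w) \<in> parcs G"
    then have "{v, w} \<in> edge_set G" by (simp add: edge_set_iff)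
    then show "w \<in> {v}" using no by blast
  qed (use assms(3) in simp_all)
  then have "pverts G = {v}" by simp
  obtain e where "e \<in> edge_set G" using assms(2) by blast
  then obtain a b where "a \<noteq> b" "a \<in> pverts G" "b \<in> pverts G" by (rule edgeE)
  then show False using \<open>pverts G = {v}\<close> by simp
qed

text \<open>Otherwise a single edge would be closed under intersection and hence be the whole edge
  set.\<close>

lemma adjacent_edges_exist:
  assumes conn: "Digraph_Component.connected (with_proj G)" and "2 \<le> card (edge_set G)"
  obtains u v w where "{u, v} \<in> edge_set G" "{u, w} \<in> edge_set G" "u \<noteq> v" "u \<noteq> w" "v \<noteq> w"
proof -
  have "edge_set G \<noteq> {}" using assms(2) by force
  then obtain e where e: "e \<in> edge_set G" by blast
  have "\<exists>f\<in>edge_set G. f \<noteq> e \<and> e \<inter> f \<noteq> {}"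
  proof (rule ccontr)
    assume "\<not> ?thesis"
    then have "{e} = edge_set G" using e by (intro line_closedD[OF conn, of "{e}" e]) auto
    then have "card (edge_set G) = card {e}" by simp
    then show False using assms(2) by simp
  qed
  then obtain f u where f: "f \<in> edge_set G" "f \<noteq> e" "u \<in> e" "u \<in> f" by blast
  obtain v where "e = {u, v}" "u \<noteq> v" using e f(3) by (rule incident_edgeE)
  moreover obtain w where "f = {u, w}" "u \<noteq> w" using f(1,4) by (rule incident_edgeE)
  ultimately show thesis using that[of u v w] e f by blast
qed

text \<open>Fix edges \<open>{u, v}\<close> and \<open>{u, w}\<close>. An edge avoiding
  \<open>u\<close> meets both only if it is \<open>{v, w}\<close>. If that edge is present, the
  graph is a triangle; otherwise all edges pass through \<open>u\<close> and the graph is a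
  star.\<close>

lemma intersecting_edges_imp_star_or_triangle:
  assumes conn: "Digraph_Component.connected (with_proj G)" and "2 \<le> card (edge_set G)"
    and inter: "\<And>e f. e \<in> edge_set G \<Longrightarrow> f \<in> edge_set G \<Longrightarrow> e \<inter> f \<noteq> {}"
  shows "(\<exists>m. complete_bipartite_digraph 1 m (with_proj G)) \<or> complete_digraph 3 (with_proj G)"
proof -
  obtain u v w where uvw: "{u, v} \<in> edge_set G" "{u, w} \<in> edge_set G" "u \<noteq> v" "u \<noteq> w" "v \<noteq> w"
    using conn assms(2) by (rule adjacent_edges_exist)
  have off: "g = {v, w}" if g: "g \<in> edge_set G" "u \<notin> g" for g
  proof -
    have "v \<in> g" "w \<in> g" using inter[OF g(1) uvw(1)] inter[OF g(1) uvw(2)] g(2) by auto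
    moreover obtain t where "g = {v, t}" using g(1) \<open>v \<in> g\<close> by (rule incident_edgeE)
    ultimately show ?thesis using uvw(5) by auto
  qed
  have E: "edge_set G \<noteq> {}" using uvw by blast
  note cover = vertex_has_edge[OF conn E]
  have V: "u \<in> pverts G" "v \<in> pverts G" "w \<in> pverts G"
    using uvw edge_subset by blast+
  show ?thesis
  proof (cases "{v, w} \<in> edge_set G")
    case True
    have "g \<subseteq> {u, v, w}" if g: "g \<in> edge_set G" for g
    proof (cases "u \<in> g")
      case u: True
      obtain t where t: "g = {u, t}" using g u by (rule incident_edgeE)
      then show ?thesis using inter[OF g True] uvw by auto
    next
      case False
      then show ?thesis using off[OF g] by blast
    qed
    then have V3: "pverts G = {u, v, w}" using cover V by blast
    have "(a, b) \<in> parcs G" if "a \<in> {u, v, w}" "b \<in> {u, v, w}" "a \<noteq> b" for a b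
    proof -
      have "{u, v} \<in> edge_set G" "{v, u} \<in> edge_set G" "{u, w} \<in> edge_set G" "{w, u} \<in> edge_set G"
        "{v, w} \<in> edge_set G" "{w, v} \<in> edge_set G"
        using True uvw(1,2) by (simp_all add: insert_commute)
      then show ?thesis using that unfolding edge_set_iff by blast
    qed
    then have "parcs G = {(a, b). (a, b) \<in> pverts G \<times> pverts G \<and> a \<noteq> b}"
    proof (intro subset_antisym subsetI)
      fix p assume "p \<in> parcs G"
      moreover obtain a b where "p = (a, b)" by (cases p)
      ultimately show "p \<in> {(a, b). (a, b) \<in> pverts G \<times> pverts G \<and> a \<noteq> b}"
        using in_arcsD1 in_arcsD2 no_loops' by simp
    qed (use V3 in auto)
    then show ?thesis using V3 uvw by (simp add: complete_digraph_pair_def)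
  next
    case False
    then have u: "u \<in> g" if "g \<in> edge_set G" for g using off that by blast
    have "parcs G = {u} \<times> (pverts G - {u}) \<union> (pverts G - {u}) \<times> {u}"
    proof (intro subset_antisym subsetI)
      fix a assume "a \<in> parcs G"
      moreover obtain b d where "a = (b, d)" by (cases a)
      ultimately show "a \<in> {u} \<times> (pverts G - {u}) \<union> (pverts G - {u}) \<times> {u}"
        using u[of "{b, d}"] in_arcsD1[of b d] in_arcsD2[of b d] no_loops'[of b d] by (auto simp: edge_set_iff)
    next
      have ut: "(u, t) \<in> parcs G" if t: "t \<in> pverts G - {u}" for t
      proof -
        obtain g where g: "g \<in> edge_set G" "t \<in> g" using cover t by blast
        obtain s where "g = {u, s}" using g(1) u[OF g(1)] by (rule incident_edgeE)
        then have "g = {u, t}" using g(2) t by auto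
        then show ?thesis using g(1) by (simp add: edge_set_iff)
      qed
      fix a assume "a \<in> {u} \<times> (pverts G - {u}) \<union> (pverts G - {u}) \<times> {u}"
      then obtain t where "t \<in> pverts G - {u}" "a = (u, t) \<or> a = (t, u)" by blast
      then show "a \<in> parcs G" using ut[of t] arcs_symmetric[of u t] by blast
    qed
    moreover have "pverts G = {u} \<union> (pverts G - {u})" using V(1) by blast
    moreover have "{u} \<inter> (pverts G - {u}) = {}" by blast
    moreover have "card {u} = 1" by simp
    ultimately have "complete_bipartite_digraph 1 (card (pverts G - {u})) (with_proj G)"
      unfolding complete_bipartite_digraph_pair_def
      by (intro conjI pair_finite_verts exI[of _ "{u}"] exI[of _ "pverts G - {u}"] refl)
    then show ?thesis by blast
  qed
qed

text \<open>Take a longest path from the vertex \<open>w\<close> of degree at most 1. Before its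
  last vertex the degree bounds leave only neighbors on the path, and at the last vertex maximality
  does. So the path is closed under arcs and spans the graph.\<close>

lemma path_graph_isoI:
  assumes conn: "Digraph_Component.connected (with_proj G)"
    and deg: "\<And>v a b d. (v, a) \<in> parcs G \<Longrightarrow> (v, b) \<in> parcs G \<Longrightarrow> (v, d) \<in> parcs G \<Longrightarrow> a = b \<or> a = d \<or> b = d"
    and w: "w \<in> pverts G" and leaf: "\<And>a b. (w, a) \<in> parcs G \<Longrightarrow> (w, b) \<in> parcs G \<Longrightarrow> a = b"
  shows "\<exists>n. digraph_iso (with_proj G) (with_proj (path_graph n))"
proof -
  define P where "P = (\<lambda>xs. xs \<noteq> [] \<and> xs ! 0 = w \<and> distinct xs \<and> set xs \<subseteq> pverts G \<and>
    (\<forall>i. Suc i < length xs \<longrightarrow> (xs ! i, xs ! Suc i) \<in> parcs G))"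
  have "P [w]" using w by (simp add: P_def)
  moreover have "length xs \<le> card (pverts G)" if "P xs" for xs
    using that card_mono[OF pair_finite_verts, of "set xs"] by (simp add: P_def distinct_card)
  ultimately have "\<exists>xs. P xs \<and> (\<forall>ys. P ys \<longrightarrow> length ys \<le> length xs)"
    by (intro ex_has_greatest_nat[of P "[w]" length "Suc (card (pverts G))"]) (auto simp: less_Suc_eq_le)
  then obtain xs where xs: "P xs" and max: "\<And>ys. P ys \<Longrightarrow> length ys \<le> length xs"
    by blast
  let ?n = "length xs"
  have n: "0 < ?n" and dist: "distinct xs" and sub: "set xs \<subseteq> pverts G"
    and arc: "\<And>i. Suc i < ?n \<Longrightarrow> (xs ! i, xs ! Suc i) \<in> parcs G" and hd: "xs ! 0 = w"
    using xs by (auto simp: P_def)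
  have inner: "y = xs ! Suc i \<or> (i \<noteq> 0 \<and> y = xs ! (i - 1))" if i: "Suc i < ?n" and y: "(xs ! i, y) \<in> parcs G" for i y
  proof (cases i)
    case 0
    then show ?thesis using leaf[of y "xs ! Suc 0"] arc[OF i] y hd by simp
  next
    case (Suc m)
    have "xs ! m \<noteq> xs ! Suc i" using dist i Suc by (simp add: nth_eq_iff_index_eq)
    then show ?thesis
      using deg[of "xs ! i" y "xs ! Suc i" "xs ! m"] arc[OF i] arcs_symmetric[OF arc[of m]] i y Suc by auto
  qed
  have closed: "y \<in> set xs" if i: "i < ?n" and y: "(xs ! i, y) \<in> parcs G" for i y
  proof (cases "Suc i < ?n")
    case True
    then show ?thesis using inner[OF True y] i by (metis less_imp_diff_less nth_mem)
  next
    case False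
    then have i': "?n = Suc i" using i by simp
    show ?thesis
    proof (rule ccontr)
      assume "y \<notin> set xs"
      then have "P (xs @ [y])"
        using xs y in_arcsD2[OF y] i' unfolding P_def by (auto simp: nth_append less_Suc_eq)
      then show False using max[of "xs @ [y]"] by simp
    qed
  qed
  have V: "set xs = pverts G"
  proof (rule connectedD_closed[OF pair_graph conn sub])
    show "w \<in> set xs" using n hd by (metis nth_mem)
    show "v \<in> set xs" if "u \<in> set xs" "(u, v) \<in> parcs G" for u v
      using closed that by (metis in_set_conv_nth)
  qed
  \<comment> \<open>The earlier of two adjacent path vertices is not the last one, so
    \<open>inner\<close> applies to it; distinctness excludes its predecessor.\<close>
  have lt: "j = Suc i" if "i < j" "j < ?n" "(xs ! i, xs ! j) \<in> parcs G" for i j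
  proof -
    have "xs ! j = xs ! Suc i \<or> (i \<noteq> 0 \<and> xs ! j = xs ! (i - 1))" using inner[of i "xs ! j"] that by simp
    then show ?thesis using that dist by (auto simp: nth_eq_iff_index_eq)
  qed
  have "digraph_iso (with_proj G) (with_proj (path_graph ?n))"
  proof (rule digraph_isoI[where p = "(!) xs"])
    show "pair_wf_digraph G" by (rule pair_wf_digraph)
    show "inj_on ((!) xs) (pverts (path_graph ?n))"
      using dist by (auto simp: path_graph_def inj_on_def nth_eq_iff_index_eq)
    show "pverts G = (!) xs ` pverts (path_graph ?n)"
      using V by (auto simp: path_graph_def set_conv_nth)
    show "parcs (path_graph ?n) \<subseteq> pverts (path_graph ?n) \<times> pverts (path_graph ?n)"
      by (auto simp: path_graph_def)
    show "parcs G = map_prod ((!) xs) ((!) xs) ` parcs (path_graph ?n)"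
    proof (intro subset_antisym subsetI)
      fix a assume a: "a \<in> parcs G"
      obtain s t where st: "a = (s, t)" by (cases a)
      then have "s \<in> set xs" "t \<in> set xs" using a in_arcsD1 in_arcsD2 V by auto
      then obtain i j where ij: "i < ?n" "j < ?n" "s = xs ! i" "t = xs ! j" by (auto simp: in_set_conv_nth)
      have "i \<noteq> j" using no_loops' a st ij by blast
      then have "j = Suc i \<or> i = Suc j"
        using lt[of i j] lt[of j i] a st ij arcs_symmetric[of s t] by (cases "i < j") auto
      then have "(i, j) \<in> parcs (path_graph ?n)" using ij by (simp add: path_graph_def)
      then show "a \<in> map_prod ((!) xs) ((!) xs) ` parcs (path_graph ?n)" using st ij by force
    next
      fix a assume "a \<in> map_prod ((!) xs) ((!) xs) ` parcs (path_graph ?n)"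
      then show "a \<in> parcs G" using arc arcs_symmetric by (auto simp: path_graph_def)
    qed
  qed
  then show ?thesis by blast
qed

end

lemma parcs_net_graph: "parcs net_graph = {(0, 1), (1, 2), (2, 0), (0, 3), (1, 4), (2, 5),
    (1, 0), (2, 1), (0, 2), (3, 0), (4, 1), (5, 2)}"
  by (auto simp: net_graph_def Let_def)

lemma edge_set_net_graph: "edge_set net_graph = {{0, 1}, {1, 2}, {2, 0}, {0, 3}, {1, 4}, {2, 5}}"
proof -
  have "edge_set net_graph = (\<lambda>(u, v). {u, v}) ` parcs net_graph"
    by (auto simp: edge_set_def)
  then show ?thesis by (simp add: parcs_net_graph insert_commute)
qed

lemma pverts_net_graph: "pverts net_graph = {0, 1, 2, 3, 4, 5}"
  by (auto simp: net_graph_def Let_def)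

lemma (in pair_graph) net_graph_isoI:
  assumes "distinct [a0, a1, a2, a3, a4, a5]" and V: "pverts G = {a0, a1, a2, a3, a4, a5}"
    and E: "edge_set G = {{a0, a1}, {a1, a2}, {a2, a0}, {a0, a3}, {a1, a4}, {a2, a5}}"
  shows "digraph_iso (with_proj G) (with_proj net_graph)"
proof (rule digraph_isoI[where p = "(!) [a0, a1, a2, a3, a4, a5]"])
  let ?p = "(!) [a0, a1, a2, a3, a4, a5]"
  show "pair_wf_digraph G" by (rule pair_wf_digraph)
  show "inj_on ?p (pverts net_graph)" unfolding pverts_net_graph using assms(1) by (simp add: insert_commute)
  show "pverts G = ?p ` pverts net_graph" unfolding pverts_net_graph V by simp
  show "parcs net_graph \<subseteq> pverts net_graph \<times> pverts net_graph"
    by (simp add: parcs_net_graph pverts_net_graph)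
  have "parcs G = {(u, v). {u, v} \<in> edge_set G}" by (auto simp: edge_set_iff)
  also have "\<dots> = {(a0, a1), (a1, a2), (a2, a0), (a0, a3), (a1, a4), (a2, a5),
      (a1, a0), (a2, a1), (a0, a2), (a3, a0), (a4, a1), (a5, a2)}"
    unfolding E set_eq_iff by (simp add: doubleton_eq_iff disj_commute disj_left_commute)
  finally show "parcs G = map_prod ?p ?p ` parcs net_graph"
    by (simp add: parcs_net_graph)
qed

subsection \<open>Graphs with a Hoffman colorable line graph\<close>

context hoffman_edge_coloring
begin

lemma edges_nonempty: "E \<noteq> {}"
  using two_edges by force

lemma edge_pos: "e \<in> E \<Longrightarrow> u \<in> e \<Longrightarrow> 0 < weight (c e) u"
  using weight_eq x_pos by simp

lemma k_ge_2: "2 \<le> k"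
proof -
  obtain u v w where e: "{u, v} \<in> E" "{u, w} \<in> E" and "v \<noteq> w" "u \<noteq> v"
    using conn two_edges by (rule adjacent_edges_exist)
  then have "{u, v} \<noteq> {u, w}" by (auto simp: doubleton_eq_iff)
  then have "c {u, v} \<noteq> c {u, w}" using color_inj[OF e, of u] by auto
  then show ?thesis using color_less[OF e(1)] color_less[OF e(2)] by linarith
qed

text \<open>A nonzero \<open>weight j v\<close> means that color \<open>j\<close> occurs at
  \<open>v\<close>, and properness lets it occur only once. So the color classes are perfect
  matchings.\<close>

lemma all_full_imp_one_factorable:
  assumes full: "\<And>v j. v \<in> pverts G \<Longrightarrow> j < k \<Longrightarrow> weight j v \<noteq> 0"
  shows "one_factorable G"
proof -
  define C where "C = (\<lambda>j. {e \<in> E. c e = j})"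
  let ?P = "C ` {..<k}"
  have factor: "\<exists>!e. e \<in> C j \<and> v \<in> e" if v: "v \<in> pverts G" and j: "j < k" for v j
  proof -
    obtain e where e: "e \<in> E" "v \<in> e" "c e = j" using full[OF v j] by (rule edge_of_weight)
    show ?thesis
    proof (rule ex1I)
      show "e \<in> C j \<and> v \<in> e" using e by (simp add: C_def)
      show "f = e" if "f \<in> C j \<and> v \<in> f" for f using color_inj[of f e v] e that by (simp add: C_def)
    qed
  qed
  obtain e where "e \<in> E" using edges_nonempty by blast
  then obtain v where v: "v \<in> pverts G" by (meson edgeE)
  have nonempty: "C j \<noteq> {}" if "j < k" for j using factor[OF v that] by blast
  have "partition_on E ?P"
  proof (rule partition_onI)
    show "\<Union> ?P = E" using color_less by (auto simp: C_def)
    show "{} \<notin> ?P" using nonempty by (metis imageE lessThan_iff)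
    show "disjnt p q" if pq: "p \<in> ?P" "q \<in> ?P" "p \<noteq> q" for p q
    proof -
      obtain i j where "p = C i" "q = C j" using pq by blast
      then show ?thesis using pq(3) by (auto simp: C_def disjnt_def)
    qed
  qed
  moreover have "one_factor G M" if M: "M \<in> ?P" for M
  proof -
    obtain j where j: "j < k" "M = C j" using M by blast
    moreover have "C j \<subseteq> E" by (auto simp: C_def)
    ultimately show ?thesis using factor[OF _ j(1)] by (simp add: one_factor_def)
  qed
  ultimately show ?thesis unfolding one_factorable_def by blast
qed

text \<open>On an edge with the maximal entry \<open>M\<close>, the weights of another color at the
  two ends add up to \<open>2 * M\<close> while each is at most \<open>M\<close>, so both are
  \<open>M\<close>. Hence all adjacent edges have entry \<open>M\<close> too, and connectedness
  spreads this to every edge.\<close>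

lemma theta_2_imp_full:
  assumes "\<theta> = 2" "v \<in> pverts G" "j < k"
  shows "weight j v \<noteq> 0"
proof -
  define M where "M = Max (x ` E)"
  have le: "x e \<le> M" if "e \<in> E" for e using that by (simp add: M_def)
  have "M \<in> x ` E" unfolding M_def using edges_nonempty by (intro Max_in) simp_all
  then obtain e0 where e0: "e0 \<in> E" "x e0 = M" by auto
  then have "M > 0" using x_pos by force
  have weight_le: "weight i w \<le> M" for i w
  proof (cases "weight i w = 0")
    case False
    then obtain e where "e \<in> E" "w \<in> e" "c e = i" by (rule edge_of_weight)
    then show ?thesis using weight_eq le by force
  qed (use \<open>M > 0\<close> in simp)
  have max: "weight i w = M" if e: "e \<in> E" "x e = M" "w \<in> e" and i: "i < k" for e w i
  proof (cases "c e = i")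
    case True
    then show ?thesis using weight_eq e by blast
  next
    case False
    obtain a where "e = {w, a}" using e(1,3) by (rule incident_edgeE)
    then have "weight i w + weight i a = 2 * M" using weight_sum[OF e(1) _ i False] e(2) assms(1) by simp
    then show ?thesis using weight_le[of i w] weight_le[of i a] by linarith
  qed
  have "{e \<in> E. x e = M} = E"
  proof (rule line_closedD[OF conn, of _ e0])
    fix e f assume e: "e \<in> {e \<in> E. x e = M}" and f: "f \<in> E" "e \<inter> f \<noteq> {}"
    then obtain w where w: "w \<in> e" "w \<in> f" by blast
    then have "x f = M" using max[of e w "c f"] e f(1) color_less weight_eq by simp
    then show "f \<in> {e \<in> E. x e = M}" using f by simp
  qed (use e0 in auto)
  moreover obtain e where "e \<in> E" "v \<in> e" using vertex_has_edge[OF conn edges_nonempty assms(2)] by blast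
  ultimately have "weight j v = M" using max[of e v j] assms(3) by blast
  then show ?thesis using \<open>M > 0\<close> by simp
qed

section \<open>Invariants of two-colored components\<close>

text \<open>
  Along a path alternating between the colors \<open>i\<close> and \<open>j\<close> the weights satisfy the recurrence
  \<open>y\<^sub>n\<^sub>+\<^sub>1 + y\<^sub>n\<^sub>-\<^sub>1 = \<theta> y\<^sub>n\<close>, and this is its quadratic invariant.
\<close>
definition kempe_invariant :: "nat \<Rightarrow> nat \<Rightarrow> 'a \<Rightarrow> real" where
  "kempe_invariant i j v = (weight i v)\<^sup>2 + (weight j v)\<^sup>2 - \<theta> * weight i v * weight j v"

lemma kempe_invariant_commute: "kempe_invariant i j v = kempe_invariant j i v"
  by (simp add: kempe_invariant_def)

text \<open>The ends of \<open>f\<close> share the weight of \<open>i\<close>, and their weights of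
  \<open>j\<close> add up to \<open>\<theta> * x f\<close>. The invariant, as a quadratic in the
  weight of \<open>j\<close>, takes equal values at two arguments with this sum.\<close>

lemma kempe_invariant_step:
  assumes f: "f \<in> E" "f = {u, v}" and ij: "j < k" "i \<noteq> j" "c f = i"
  shows "kempe_invariant i j u = kempe_invariant i j v"
proof -
  have u: "weight i u = x f" "weight i v = x f" using weight_eq[OF f(1)] f(2) ij(3) by auto
  have v: "weight j u = \<theta> * x f - weight j v" using weight_sum[OF f ij(1)] ij(2,3) by simp
  show ?thesis by (simp add: kempe_invariant_def u v power2_eq_square algebra_simps)
qed

text \<open>A level set of the invariant is a union of components of the subgraph in the colors
  \<open>i\<close> and \<open>j\<close>. If it contained \<open>u\<close> but not \<open>v\<close>,
  \<open>kempe_balance\<close> at \<open>e\<close> would force equal weights of \<open>i\<close> and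
  \<open>j\<close> at \<open>u\<close>.\<close>

lemma kempe_invariant_eq:
  assumes e: "e \<in> E" "e = {u, v}" "c e \<noteq> i" "c e \<noteq> j" and ij: "i < k" "j < k"
    and neq: "weight i u \<noteq> weight j u"
  shows "kempe_invariant i j v = kempe_invariant i j u"
proof -
  define U where "U = {w. kempe_invariant i j w = kempe_invariant i j u}"
  have "i \<noteq> j" using neq by auto
  have closed: "f \<subseteq> U" if f: "f \<in> E" "c f = i \<or> c f = j" "f \<inter> U \<noteq> {}" for f
  proof -
    obtain a where a: "a \<in> f" "a \<in> U" using f(3) by blast
    obtain b where b: "f = {a, b}" using f(1) a(1) by (rule incident_edgeE)
    have "kempe_invariant i j a = kempe_invariant i j b"
      using f(2)
    proof
      assume "c f = i"
      then show ?thesis using kempe_invariant_step[OF f(1) b ij(2) \<open>i \<noteq> j\<close>] by simp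
    next
      assume "c f = j"
      then show ?thesis using kempe_invariant_step[OF f(1) b ij(1)] \<open>i \<noteq> j\<close>
        by (simp add: kempe_invariant_commute[of i j])
    qed
    then show ?thesis using a(2) b by (simp add: U_def)
  qed
  have "v \<in> U"
  proof (rule ccontr)
    assume "v \<notin> U"
    then show False
      using kempe_balance[of i j U e u v] closed ij \<open>i \<noteq> j\<close> e neq by (simp add: U_def)
  qed
  then show ?thesis by (simp add: U_def)
qed

text \<open>Compare the invariant of the colors \<open>c a\<close> and \<open>r\<close> at the ends
  of \<open>b = {u, v}\<close>. The weights are \<open>x a\<close> and 0 at \<open>u\<close>, and
  \<open>t - x a\<close> and \<open>t\<close> at \<open>v\<close> with
  \<open>t = \<theta> * x b\<close>, so the invariants differ by
  \<open>(2 - \<theta>) * t * (t - x a)\<close>.\<close>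

lemma missing_color_weight:
  assumes "\<theta> < 2" and ab: "a \<in> E" "b \<in> E" "u \<in> a" "u \<in> b" "a \<noteq> b" and r: "r < k" "weight r u = 0"
  shows "\<theta> * x b = x a"
proof -
  obtain v where v: "b = {u, v}" using ab(2,4) by (rule incident_edgeE)
  have wa: "weight (c a) u = x a" using ab by (intro weight_eq)
  have cab: "c a \<noteq> c b" using color_inj[of a b u] ab by blast
  have ra: "r \<noteq> c a" using wa x_pos[OF ab(1)] r(2) by auto
  have rb: "r \<noteq> c b" using edge_pos[OF ab(2,4)] r(2) by auto
  have ca: "c a < k" using color_less ab(1) by simp
  define t where "t = \<theta> * x b"
  have "t > 0" using theta_ge x_pos[OF ab(2)] by (simp add: t_def)
  have 1: "weight r v = t" using weight_sum[OF ab(2) v r(1)] rb r(2) by (simp add: t_def)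
  have 2: "weight (c a) v = t - x a" using weight_sum[OF ab(2) v ca] cab wa by (simp add: t_def)
  have "kempe_invariant (c a) r v = kempe_invariant (c a) r u"
    using ab(2) v cab[symmetric] rb[symmetric] ca r(1)
    by (rule kempe_invariant_eq) (use wa r(2) x_pos[OF ab(1)] in simp)
  then have "(2 - \<theta>) * t * (t - x a) = 0"
    by (simp add: kempe_invariant_def 1 2 wa r(2) power2_eq_square algebra_simps)
  then have "t - x a = 0" using \<open>t > 0\<close> assms(1) by simp
  then show ?thesis by (simp add: t_def)
qed

lemma theta_eq_1I: "\<theta> * (\<theta> * t) = t \<Longrightarrow> 0 < t \<Longrightarrow> \<theta> = 1"
proof -
  assume t: "\<theta> * (\<theta> * t) = t" "0 < t"
  then have "(\<theta> - 1) * ((\<theta> + 1) * t) = 0" by (simp add: algebra_simps)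
  then show ?thesis using theta_ge t(2) by simp
qed

text \<open>\<open>missing_color_weight\<close> applies to the two edges in both orders and makes
  each entry \<open>\<theta>\<close> times the other. So strictly between 1 and 2 only leaves can
  miss a color.\<close>

lemma degree_2_imp_full:
  assumes "\<theta> < 2" "\<theta> \<noteq> 1" and ab: "a \<in> E" "b \<in> E" "u \<in> a" "u \<in> b" "a \<noteq> b" and r: "r < k"
  shows "weight r u \<noteq> 0"
proof
  assume "weight r u = 0"
  then have 1: "\<theta> * x b = x a" and 2: "\<theta> * x a = x b"
    using missing_color_weight[of a b u r] missing_color_weight[of b a u r] assms by auto
  then have "\<theta> = 1" using theta_eq_1I[of "x a"] x_pos[OF ab(1)] by simp
  then show False using assms(2) by simp
qed

section \<open>The extreme value \<theta> = 1\<close>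

text \<open>On an induced path the vector \<open>(1, -1, 1)\<close> has Rayleigh quotient \<open>-4/3 < -1\<close>.\<close>
lemma adjacency_transitive_if_theta_1:
  assumes "\<theta> = 1" and efg: "e \<in> E" "f \<in> E" "g \<in> E" and "e \<inter> f \<noteq> {}" "f \<inter> g \<noteq> {}"
  shows "e \<inter> g \<noteq> {}"
proof (rule ccontr)
  assume no: "\<not> ?thesis"
  have ne: "e \<noteq> f" "f \<noteq> g" "e \<noteq> g" using no assms(5,6) by blast+
  define z :: "'a set \<Rightarrow> real"
    where "z = (\<lambda>h. (if h = e then 1 else 0) + (if h = g then 1 else 0) + (if h = f then -1 else 0))"
  have z: "(\<Sum>h\<in>E. B h * z h) = B e + B g - B f" for B
    using efg by (simp add: z_def distrib_left sum.distrib if_distrib[of "\<lambda>t. B _ * t"] cong: if_cong)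
  have "quad_form E A z = (\<Sum>h\<in>E. z h * (A h e + A h g - A h f))"
    unfolding quad_form_def z ..
  also have "\<dots> = (\<Sum>h\<in>E. (A h e + A h g - A h f) * z h)"
    by (simp only: mult.commute)
  also have "\<dots> = - 4"
    unfolding z using assms no ne by (simp add: adj_def Int_commute)
  finally have "quad_form E A z = - 4" .
  moreover have "(\<Sum>h\<in>E. (z h)\<^sup>2) = 3"
    unfolding power2_eq_square z using ne by (simp add: z_def)
  ultimately show False using form_bound[of z] assms(1) by simp
qed

lemma intersecting_if_theta_1:
  assumes "\<theta> = 1" "e \<in> E" "f \<in> E"
  shows "e \<inter> f \<noteq> {}"
proof -
  have "{f \<in> E. e \<inter> f \<noteq> {}} = E"
  proof (rule line_closedD[OF conn])
    show "e \<in> {f \<in> E. e \<inter> f \<noteq> {}}" using assms(2) by (auto elim: edgeE)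
    show "g \<in> {f \<in> E. e \<inter> f \<noteq> {}}" if "h \<in> {f \<in> E. e \<inter> f \<noteq> {}}" "g \<in> E" "h \<inter> g \<noteq> {}" for h g
      using adjacency_transitive_if_theta_1[OF assms(1,2), of h g] that by simp
  qed simp
  then show ?thesis using assms(3) by blast
qed

section \<open>Leaves and the net\<close>

definition leaf_edge :: "'a set \<Rightarrow> 'a \<Rightarrow> 'a \<Rightarrow> bool" where
  "leaf_edge l w u \<longleftrightarrow> l \<in> E \<and> l = {w, u} \<and> (\<forall>f\<in>E. w \<in> f \<longrightarrow> f = l)"

text \<open>The leaf \<open>w\<close> misses all colors but that of \<open>l\<close>, so
  \<open>weight_sum\<close> leaves the full amount at \<open>u\<close>. In particular every color
  occurs at \<open>u\<close>.\<close>

lemma leaf_edge_weight: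
  assumes l: "leaf_edge l w u" and "j < k" "j \<noteq> c l"
  shows "weight j u = \<theta> * x l"
proof -
  have "weight j w = 0" using l assms(3) by (intro weight_eq_0) (auto simp: leaf_edge_def)
  moreover have "l \<in> E" "l = {w, u}" using l unfolding leaf_edge_def by blast+
  ultimately show ?thesis using weight_sum[of l w u j] assms(2,3) by simp
qed

text \<open>By \<open>leaf_edge_weight\<close> each of the two entries is \<open>\<theta>\<close>
  times the other.\<close>

lemma two_leaf_edges:
  assumes l: "leaf_edge l w u" and l': "leaf_edge l' w' u" and "l \<noteq> l'"
  shows "\<theta> = 1"
proof -
  have E: "l \<in> E" "l' \<in> E" "u \<in> l" "u \<in> l'" using l l' by (auto simp: leaf_edge_def)
  then have "c l \<noteq> c l'" using color_inj assms(3) by blast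
  then have "x l' = \<theta> * x l" "x l = \<theta> * x l'"
    using leaf_edge_weight[OF l, of "c l'"] leaf_edge_weight[OF l', of "c l"] weight_eq[of l' u]
      weight_eq[of l u] color_less E by auto
  then show ?thesis using theta_eq_1I[of "x l"] x_pos[OF E(1)] by simp
qed

lemma leaf_edgeI:
  assumes "\<theta> < 2" "\<theta> \<noteq> 1" "l \<in> E" "l = {w, u}" "r < k" "weight r w = 0"
  shows "leaf_edge l w u"
  using degree_2_imp_full[OF assms(1,2,3), of _ w r] assms(3-6) by (auto simp: leaf_edge_def)

text \<open>Let \<open>X = x l\<close>. The weights of \<open>c l\<close> and \<open>r\<close> are
  \<open>X\<close> and \<open>\<theta> X\<close> at \<open>u\<close>, and
  \<open>(\<theta>\<^sup>2 - 1) X\<close> and \<open>(\<theta>\<^sup>2 - \<theta>) X\<close> at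
  \<open>v\<close>. Equal invariants force \<open>\<theta>\<^sup>2 = \<theta> + 1\<close>, so an
  edge \<open>g\<close> of color \<open>r\<close> and entry \<open>X\<close> leaves
  \<open>v\<close>. At its far end \<open>c l\<close> has weight
  \<open>\<theta> X - \<theta> X = 0\<close>, which makes that end a leaf.\<close>

lemma leaf_edge_propagates:
  assumes \<theta>: "\<theta> < 2" "\<theta> \<noteq> 1" and l: "leaf_edge l w u" and e: "e \<in> E" "e = {u, v}" "c e \<noteq> c l"
    and r: "r < k" "r \<noteq> c l" "r \<noteq> c e"
  obtains g w' where "leaf_edge g w' v" "c g = r"
proof -
  have lE: "l \<in> E" "u \<in> l" using l by (auto simp: leaf_edge_def)
  define X where "X = x l"
  have X: "X > 0" using x_pos lE by (simp add: X_def)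
  have p: "c l < k" using color_less lE by simp
  have xe: "x e = \<theta> * X" using leaf_edge_weight[OF l color_less[OF e(1)] e(3)] weight_eq[OF e(1)] e(2)
    by (simp add: X_def)
  have ru: "weight r u = \<theta> * X" using leaf_edge_weight[OF l r(1,2)] by (simp add: X_def)
  have pu: "weight (c l) u = X" using weight_eq[OF lE] by (simp add: X_def)
  have pv: "weight (c l) v = \<theta> * (\<theta> * X) - X"
    using weight_sum[OF e(1,2) p e(3)] pu xe by simp
  have rv: "weight r v = \<theta> * (\<theta> * X) - \<theta> * X"
    using weight_sum[OF e(1,2) r(1)] r(3) ru xe by simp
  have "kempe_invariant (c l) r v = kempe_invariant (c l) r u"
    using e(1,2,3) r(3)[symmetric] p r(1) by (rule kempe_invariant_eq) (use pu ru X \<theta>(2) in simp)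
  moreover have "kempe_invariant (c l) r v - kempe_invariant (c l) r u =
      X\<^sup>2 * (\<theta>\<^sup>2 * ((2 - \<theta>) * (\<theta> * \<theta> - \<theta> - 1)))"
    unfolding kempe_invariant_def pu ru pv rv by (simp add: algebra_simps power2_eq_square)
  ultimately have "X\<^sup>2 * (\<theta>\<^sup>2 * ((2 - \<theta>) * (\<theta> * \<theta> - \<theta> - 1))) = 0" by simp
  then have golden: "\<theta> * \<theta> = \<theta> + 1" using X \<theta>(1) theta_ge by simp
  then have tt: "\<theta> * (\<theta> * t) = \<theta> * t + t" for t by (metis distrib_right mult.assoc mult_1)
  have "weight r v = X" using rv tt by simp
  then have "weight r v \<noteq> 0" using X by simp
  then obtain g where g: "g \<in> E" "v \<in> g" "c g = r" by (rule edge_of_weight)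
  obtain w' where w': "g = {v, w'}" using g(1,2) by (rule incident_edgeE)
  have xg: "x g = X" using weight_eq[OF g(1,2)] g(3) \<open>weight r v = X\<close> by simp
  have "weight (c l) w' = 0"
    using weight_sum[OF g(1) w' p] g(3) r(2) pv xg tt by simp
  then have "leaf_edge g w' v"
    using g(1) w' p by (intro leaf_edgeI[OF \<theta>, of g w' v "c l"]) (auto simp: insert_commute)
  then show thesis using g(3) by (rule that)
qed

text \<open>From the leaf at \<open>u\<close>, pendant edges propagate to its neighbors
  \<open>v\<close> and \<open>v'\<close>, and from \<open>v'\<close> on to a further neighbor
  \<open>y\<close>. Balance then shows \<open>y = v\<close>, which closes the triangle
  \<open>u\<close>, \<open>v\<close>, \<open>v'\<close>.\<close>

lemma leaf_imp_net:
  assumes \<theta>: "\<theta> < 2" "\<theta> \<noteq> 1" and k: "3 \<le> k" and l: "leaf_edge l w u"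
  shows "digraph_iso (with_proj G) (with_proj net_graph)"
proof -
  have lE: "l \<in> E" "u \<in> l" "w \<in> l" and lw: "l = {w, u}" using l by (auto simp: leaf_edge_def)
  define p where "p = c l"
  have p: "p < k" using color_less lE by (simp add: p_def)
  have "\<exists>q r. q < k \<and> r < k \<and> q \<noteq> p \<and> r \<noteq> p \<and> q \<noteq> r"
  proof (cases "p = 0")
    case True
    then show ?thesis using k by (intro exI[of _ 1] exI[of _ 2]) simp
  next
    case False
    then show ?thesis using k by (intro exI[of _ 0] exI[of _ "if p = 1 then 2 else 1"]) simp
  qed
  then obtain q r where q: "q < k" "q \<noteq> p" and r: "r < k" "r \<noteq> p" and qr: "q \<noteq> r" by blast
  have wl: "weight j u = \<theta> * x l" if "j < k" "j \<noteq> p" for j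
    using leaf_edge_weight[OF l] that by (simp add: p_def)
  have pos: "\<theta> * x l > 0" using theta_ge x_pos lE by simp
  have "weight q u \<noteq> 0" "weight r u \<noteq> 0" using pos wl[OF q] wl[OF r] by (metis less_irrefl)+
  obtain e where e: "e \<in> E" "u \<in> e" "c e = q" using \<open>weight q u \<noteq> 0\<close> by (rule edge_of_weight)
  obtain e' where e': "e' \<in> E" "u \<in> e'" "c e' = r" using \<open>weight r u \<noteq> 0\<close> by (rule edge_of_weight)
  obtain v where v: "e = {u, v}" using e(1,2) by (rule incident_edgeE)
  obtain v' where v': "e' = {u, v'}" using e'(1,2) by (rule incident_edgeE)
  obtain g wv where g: "leaf_edge g wv v" "c g = r"
    using leaf_edge_propagates[OF \<theta> l e(1) v, of r] e(3) q r qr unfolding p_def by metis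
  obtain g' wv' where g': "leaf_edge g' wv' v'" "c g' = q"
    using leaf_edge_propagates[OF \<theta> l e'(1) v', of q] e'(3) q r qr unfolding p_def by metis
  have gE: "g' \<in> E" "v' \<in> g'" "wv' \<in> g'" "g' = {wv', v'}" using g'(1) by (auto simp: leaf_edge_def)
  \<comment> \<open>A fourth color would propagate across \<open>e\<close> to a second pendant edge
    at \<open>v\<close>, contrary to \<open>two_leaf_edges\<close>.\<close>
  have three: "j = p \<or> j = q \<or> j = r" if jk: "j < k" for j
  proof (rule ccontr)
    assume j: "\<not> ?thesis"
    have "c e \<noteq> c l" "j \<noteq> c l" "j \<noteq> c e" using e(3) q(2) j by (auto simp: p_def)
    then obtain h y where "leaf_edge h y v" "c h = j"
      using leaf_edge_propagates[OF \<theta> l e(1) v _ jk] by blast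
    then show False using two_leaf_edges[OF g(1), of h y] g(2) j \<theta>(2) by blast
  qed
  \<comment> \<open>Two edges meet at \<open>v'\<close>, so color \<open>p\<close> occurs there. Its
    edge \<open>d\<close> continues the path from \<open>u\<close> in the colors \<open>p\<close>
    and \<open>r\<close>, and propagating \<open>g'\<close> across \<open>d\<close> ends this path
    in the leaf \<open>wy\<close>.\<close>
  have "g' \<noteq> e'" using g'(2) e'(3) qr by blast
  then have "weight p v' \<noteq> 0"
    using degree_2_imp_full[OF \<theta> gE(1) e'(1), of v' p] gE v' p by blast
  then obtain d where d: "d \<in> E" "v' \<in> d" "c d = p" by (rule edge_of_weight)
  obtain y where y: "d = {v', y}" using d(1,2) by (rule incident_edgeE)
  obtain h wy where h: "leaf_edge h wy y" "c h = r"
    using leaf_edge_propagates[OF \<theta> g'(1) d(1) y, of r] d(3) g'(2) q r qr by metis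
  have hE: "h \<in> E" "y \<in> h" "wy \<in> h" "h = {wy, y}" using h(1) by (auto simp: leaf_edge_def)
  note inj = color_inj
  have at_w: "f = l" if "f \<in> E" "w \<in> f" for f using l that unfolding leaf_edge_def by blast
  have at_wy: "f = h" if "f \<in> E" "wy \<in> f" for f using h that unfolding leaf_edge_def by blast
  have at_wv': "f = g'" if "f \<in> E" "wv' \<in> f" for f using g' that unfolding leaf_edge_def by blast
  have at_u: "f = l \<or> f = e \<or> f = e'" if "f \<in> E" "u \<in> f" for f
    using three[OF color_less[OF that(1)]] inj[OF that(1) lE(1) that(2) lE(2)]
      inj[OF that(1) e(1) that(2) e(2)] inj[OF that(1) e'(1) that(2) e'(2)] e(3) e'(3) p_def by metis
  have at_v': "f = d \<or> f = e' \<or> f = g'" if "f \<in> E" "v' \<in> f" for f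
    using three[OF color_less[OF that(1)]] inj[OF that(1) d(1) that(2) d(2)]
      inj[OF that(1) e'(1) that(2)] inj[OF that(1) gE(1) that(2) gE(2)] d(3) e'(3) g'(2) v' by auto
  \<comment> \<open>An edge of color \<open>q\<close> at \<open>y\<close> cannot be identified yet;
    it turns out to be \<open>e\<close> once \<open>v = y\<close> is known.\<close>
  have y_eq: "f = (if c f = p then d else h)" if "f \<in> E" "y \<in> f" "c f = p \<or> c f = r" for f
    using inj[OF that(1) d(1) that(2)] inj[OF that(1) hE(1) that(2) hE(2)] d(3) h(2) y that(3) by auto
  define U where "U = {w, u, v', y, wy}"
  \<comment> \<open>\<open>U\<close> is the component of colors \<open>p\<close>, \<open>r\<close> through \<open>u\<close>; by balance at \<open>e\<close> it contains \<open>v\<close>, so \<open>v = y\<close>.\<close>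
  have closed: "f \<subseteq> U" if f: "f \<in> E" "c f = p \<or> c f = r" "f \<inter> U \<noteq> {}" for f
  proof -
    consider "w \<in> f" | "u \<in> f" | "v' \<in> f" | "y \<in> f" | "wy \<in> f" using f(3) by (auto simp: U_def)
    then have "f = l \<or> f = e' \<or> f = d \<or> f = h"
    proof cases
      case 1 then show ?thesis using at_w f(1) by blast
    next
      case 2
      then have "f \<noteq> e" using f(2) e(3) q qr by blast
      then show ?thesis using at_u f(1) 2 by blast
    next
      case 3
      then have "f \<noteq> g'" using f(2) g'(2) q qr by blast
      then show ?thesis using at_v' f(1) 3 by blast
    next
      case 4 then show ?thesis using y_eq[OF f(1) _ f(2)] by (metis (full_types))
    next
      case 5 then show ?thesis using at_wy f(1) by blast
    qed
    then show ?thesis using lw v' y hE(4) by (auto simp: U_def)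
  qed
  \<comment> \<open>With \<open>v\<close> outside \<open>U\<close>, balance at \<open>e\<close>
    would read \<open>weight p u = weight r u\<close>, that is
    \<open>x l = \<theta> * x l\<close>.\<close>
  have "v \<in> U"
  proof (rule ccontr)
    assume "v \<notin> U"
    moreover have "u \<in> U" by (simp add: U_def)
    ultimately have "weight p u = weight r u"
      using kempe_balance[of p r U e u v] closed p r q qr e(1,3) v by simp
    then show False using wl[OF r] weight_eq[OF lE(1,2)] \<theta>(2) x_pos[OF lE(1)] by (simp add: p_def)
  qed
  moreover have "v \<noteq> w" using at_w[OF e(1)] v e(3) q p_def by blast
  moreover have "v \<noteq> u" using v e(1) edge_set_iff no_loops' by blast
  moreover have "v \<noteq> v'" using v v' e(3) e'(3) qr by blast
  moreover have "v \<noteq> wy" using at_wy[OF e(1)] v e(3) h(2) qr by blast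
  ultimately have vy: "v = y" by (auto simp: U_def)
  have at_v: "f = d \<or> f = e \<or> f = h" if "f \<in> E" "v \<in> f" for f
    using three[OF color_less[OF that(1)]] y_eq[OF that(1)] that(2) vy inj[OF that(1) e(1) that(2)] e(3) v
    by (metis insertI1 insert_commute)
  let ?S = "{u, v, v', w, wy, wv'}"
  have S_edges: "f \<in> {l, e, e', d, h, g'}" if f: "f \<in> E" and s: "s \<in> ?S" "s \<in> f" for f s
  proof -
    consider "u \<in> f" | "v \<in> f" | "v' \<in> f" | "w \<in> f" | "wy \<in> f" | "wv' \<in> f"
      using s by auto
    then show ?thesis
      by cases (use at_u[OF f] at_v[OF f] at_v'[OF f] at_w[OF f] at_wy[OF f] at_wv'[OF f] in auto)
  qed
  have S_sub: "f \<subseteq> ?S" if "f \<in> {l, e, e', d, h, g'}" for f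
  proof -
    have "l \<subseteq> ?S" using lw by blast
    moreover have "e \<subseteq> ?S" using v by blast
    moreover have "e' \<subseteq> ?S" using v' by blast
    moreover have "d \<subseteq> ?S" using y vy by blast
    moreover have "h \<subseteq> ?S" using hE(4) vy by blast
    moreover have "g' \<subseteq> ?S" using gE(4) by blast
    moreover note that
    ultimately show ?thesis by (elim insertE emptyE) simp_all
  qed
  have V: "?S = pverts G"
  proof (rule connectedD_closed[OF pair_graph conn, of _ u])
    show "?S \<subseteq> pverts G"
      using edge_subset[OF e(1)] edge_subset[OF e'(1)] edge_subset[OF lE(1)] edge_subset[OF hE(1)]
        edge_subset[OF gE(1)] v v' lw hE(4) gE(4) by simp
    show "b \<in> ?S" if a: "a \<in> ?S" and ab: "(a, b) \<in> parcs G" for a b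
    proof -
      have "{a, b} \<in> E" using ab by (simp add: edge_set_iff)
      then have "{a, b} \<subseteq> ?S" using S_sub[OF S_edges[OF _ a]] by blast
      then show ?thesis by blast
    qed
  qed simp
  have "f \<in> {l, e, e', d, h, g'}" if f: "f \<in> E" for f
  proof -
    obtain s where "s \<in> f" "s \<in> pverts G" using f by (rule edgeE) blast
    then show ?thesis using S_edges[OF f] V by blast
  qed
  then have "E = {e, d, e', l, h, g'}"
    using lE(1) e(1) e'(1) d(1) hE(1) gE(1) by blast
  moreover have "d = {v, v'}" "e' = {v', u}" "l = {u, w}" "h = {v, wy}" "g' = {v', wv'}"
    using lw v' y hE(4) gE(4) vy by (simp_all add: insert_commute)
  ultimately have "E = {{u, v}, {v, v'}, {v', u}, {u, w}, {v, wy}, {v', wv'}}"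
    using v by simp
  moreover have "distinct [u, v, v', w, wy, wv']"
  proof -
    have ne: "l \<noteq> h" "l \<noteq> g'" "h \<noteq> g'" "e \<noteq> h" "e' \<noteq> l" "d \<noteq> g'" "d \<noteq> h"
      using e(3) e'(3) d(3) h(2) g'(2) p_def q r qr by auto
    have "u \<noteq> wy" using at_wy[OF e(1)] e(2) ne by blast
    moreover have "u \<noteq> wv'" using at_wv'[OF lE(1)] lE(2) ne by blast
    moreover have "u \<noteq> w" "wy \<noteq> v" "wv' \<noteq> v'" 
      using lw lE(1) hE(1,4) gE(1,4) vy edge_set_iff no_loops' by blast+
    moreover have "v \<noteq> wv'" using at_wv'[OF d(1)] y vy ne by blast
    moreover have "v' \<noteq> w" using at_w[OF e'(1)] v' ne by blast
    moreover have "v' \<noteq> wy" using at_wy[OF d(1)] d(2) ne by blast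
    moreover have "v' \<noteq> u" using v' e'(1) edge_set_iff no_loops' by blast
    moreover have "w \<noteq> wy" "w \<noteq> wv'" "wy \<noteq> wv'" using at_w at_wy hE gE ne by metis+
    ultimately show ?thesis using \<open>v \<noteq> w\<close> \<open>v \<noteq> u\<close> \<open>v \<noteq> v'\<close> by auto
  qed
  ultimately show ?thesis using V by (intro net_graph_isoI) auto
qed

text \<open>Two colors allow at most two edges at a vertex, and at most one at a vertex that misses
  a color; such a vertex is the end of the path.\<close>

lemma two_colors_imp_path:
  assumes "k = 2" "w \<in> pverts G" "r < k" "weight r w = 0"
  shows "\<exists>n. digraph_iso (with_proj G) (with_proj (path_graph n))"
proof (rule path_graph_isoI[OF conn _ assms(2)])
  have same: "a = b" if "(v, a) \<in> parcs G" "(v, b) \<in> parcs G" "c {v, a} = c {v, b}" for v a b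
  proof -
    have "{v, a} = {v, b}" using that by (intro color_inj[of _ _ v]) (auto simp: edge_set_iff)
    then show ?thesis by (auto simp: doubleton_eq_iff)
  qed
  have c2: "c {v, a} < 2" if "(v, a) \<in> parcs G" for v a
    using color_less that assms(1) by (simp add: edge_set_iff)
  show "a = b \<or> a = d \<or> b = d" if "(v, a) \<in> parcs G" "(v, b) \<in> parcs G" "(v, d) \<in> parcs G" for v a b d
    using same[of v a b] same[of v a d] same[of v b d] c2[of v a] c2[of v b] c2[of v d] that by linarith
  show "a = b" if "(w, a) \<in> parcs G" "(w, b) \<in> parcs G" for a b
  proof (rule same[OF that])
    have "c {w, t} \<noteq> r" if "(w, t) \<in> parcs G" for t
      using edge_pos[of "{w, t}" w] that assms(4) by (auto simp: edge_set_iff)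
    then show "c {w, a} = c {w, b}" using c2[of w a] c2[of w b] that assms(1,3) by (metis less_2_cases)
  qed
qed

lemma hoffman_classification:
  "one_factorable G \<or> (\<exists>m. complete_bipartite_digraph 1 m (with_proj G)) \<or>
    (\<exists>n. digraph_iso (with_proj G) (with_proj (path_graph n))) \<or> complete_digraph 3 (with_proj G) \<or>
    digraph_iso (with_proj G) (with_proj net_graph)"
proof (cases "\<forall>v\<in>pverts G. \<forall>j<k. weight j v \<noteq> 0")
  case True
  then show ?thesis using all_full_imp_one_factorable by blast
next
  case False
  then obtain w r where w: "w \<in> pverts G" "r < k" "weight r w = 0" by blast
  then have "\<theta> < 2" using theta_2_imp_full[of w r] theta_le by fastforce
  consider "\<theta> = 1" | "k = 2" | "\<theta> \<noteq> 1" "3 \<le> k" using k_ge_2 by linarith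
  then show ?thesis
  proof cases
    case 1
    then show ?thesis
      using intersecting_edges_imp_star_or_triangle[OF conn two_edges intersecting_if_theta_1] by blast
  next
    case 2
    then show ?thesis using two_colors_imp_path w by blast
  next
    case 3
    obtain l where l: "l \<in> E" "w \<in> l" using vertex_has_edge[OF conn edges_nonempty w(1)] by blast
    obtain u where "l = {w, u}" using l by (rule incident_edgeE)
    then have "leaf_edge l w u" using leaf_edgeI[OF \<open>\<theta> < 2\<close> 3(1) l(1)] w by blast
    then show ?thesis using leaf_imp_net[OF \<open>\<theta> < 2\<close> 3] by blast
  qed
qed

end

section \<open>From a Hoffman colorable line graph to the weights\<close>

context pair_graph
begin

lemma line_graph_eigenvalue_ge:
  assumes "eigenpair (line_graph G) k z"
  shows "- 2 \<le> k"
proof -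
  have "- 2 * (\<Sum>e\<in>edge_set G. (y e)\<^sup>2) \<le> quad_form (edge_set G) (adj (line_graph G)) y" for y
    using sum_nonneg[of "pverts G" "\<lambda>v. (vertex_sum G y v)\<^sup>2"] by (simp add: quad_form_line_graph)
  then show ?thesis
    using quad_form_bound_imp_eigenvalue_bound[of "line_graph G" k z "- 2"] assms by simp
qed

lemma sym_line_graph: "sym (parcs (line_graph G))"
  by (rule symI) auto

lemma line_graph_perron:
  assumes conn: "Digraph_Component.connected (with_proj G)" and ne: "edge_set G \<noteq> {}"
  shows "\<exists>x. (\<forall>e\<in>edge_set G. 0 < x e) \<and> (\<forall>e\<in>edge_set G.
    (\<Sum>f\<in>edge_set G. adj (line_graph G) e f * x f) = lambda_max (line_graph G) * x e)"
proof -
  have fin: "finite (pverts (line_graph G))" and ne': "pverts (line_graph G) \<noteq> {}" using ne by simp_all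
  have closed: "S = pverts (line_graph G)" if S: "S \<subseteq> pverts (line_graph G)" "S \<noteq> {}"
    "\<And>e f. e \<in> S \<Longrightarrow> f \<in> pverts (line_graph G) \<Longrightarrow> (e, f) \<in> parcs (line_graph G) \<Longrightarrow> f \<in> S" for S
  proof -
    obtain s where "s \<in> S" using S(2) by blast
    have "S = edge_set G"
    proof (rule line_closedD[OF conn _ \<open>s \<in> S\<close>])
      show "S \<subseteq> edge_set G" using S(1) by simp
      show "f \<in> S" if e: "e \<in> S" and f: "f \<in> edge_set G" "e \<inter> f \<noteq> {}" for e f
      proof (cases "e = f")
        case False
        moreover have "e \<in> edge_set G" using e S(1) by auto
        ultimately show ?thesis using S(3)[OF e, of f] f by simp
      qed (use e in simp)
    qed
    then show ?thesis by simp
  qed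
  have "\<exists>x. (\<forall>e\<in>pverts (line_graph G). x e > 0) \<and> (\<forall>e\<in>pverts (line_graph G).
      (\<Sum>f\<in>pverts (line_graph G). adj (line_graph G) e f * x f) = lambda_max (line_graph G) * x e)"
    by (rule perron_eigenvector[OF fin ne' sym_line_graph]) (rule closed)
  then show ?thesis by simp
qed

text \<open>The locale is instantiated with the chromatic number and minus the least eigenvalue. The
  main thing to check is that this eigenvalue lies between -2 and -1.\<close>

lemma hoffman_colorable_line_graph_imp:
  assumes conn: "Digraph_Component.connected (with_proj G)" and two: "2 \<le> card (edge_set G)"
    and hoff: "hoffman_colorable (line_graph G)"
  shows "one_factorable G \<or> (\<exists>m. complete_bipartite_digraph 1 m (with_proj G)) \<or>
    (\<exists>n. digraph_iso (with_proj G) (with_proj (path_graph n))) \<or> complete_digraph 3 (with_proj G) \<or>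
    digraph_iso (with_proj G) (with_proj net_graph)"
proof -
  let ?L = "line_graph G"
  have ne: "edge_set G \<noteq> {}" using two by force
  have fin: "finite (pverts ?L)" and ne': "pverts ?L \<noteq> {}" using ne by simp_all
  have bound: "lambda_min ?L * (\<Sum>e\<in>edge_set G. (z e)\<^sup>2) \<le> quad_form (edge_set G) (adj ?L) z" for z
    using lambda_min_eigenpair(2)[OF fin ne' sym_line_graph, of z] by simp
  obtain z where "eigenpair ?L (lambda_min ?L) z"
    using lambda_min_eigenpair(1)[OF fin ne' sym_line_graph] by blast
  then have ge: "- 2 \<le> lambda_min ?L" by (rule line_graph_eigenvalue_ge)
  have le: "lambda_min ?L \<le> - 1"
  proof -
    obtain u v w where uvw: "{u, v} \<in> edge_set G" "{u, w} \<in> edge_set G" "u \<noteq> v" "u \<noteq> w" "v \<noteq> w"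
      using conn two by (rule adjacent_edges_exist)
    define e f where "e = {u, v}" and "f = {u, w}"
    have ef: "e \<in> edge_set G" "f \<in> edge_set G" "e \<noteq> f" "e \<inter> f \<noteq> {}"
      using uvw by (auto simp: e_def f_def doubleton_eq_iff)
    \<comment> \<open>The vector with entries 1 and -1 on two adjacent edges has form -2 and squared
      norm 2.\<close>
    define y :: "'a set \<Rightarrow> real" where "y = (\<lambda>h. (if h = e then 1 else 0) + (if h = f then -1 else 0))"
    have y: "(\<Sum>h\<in>edge_set G. B h * y h) = B e - B f" for B
      using ef by (simp add: y_def distrib_left sum.distrib if_distrib[of "\<lambda>t. B _ * t"] cong: if_cong)
    have "quad_form (edge_set G) (adj ?L) y = (\<Sum>h\<in>edge_set G. y h * (adj ?L h e - adj ?L h f))"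
      unfolding quad_form_def y ..
    also have "\<dots> = (\<Sum>h\<in>edge_set G. (adj ?L h e - adj ?L h f) * y h)"
      by (simp only: mult.commute)
    also have "\<dots> = - 2"
      unfolding y using ef by (simp add: adj_def Int_commute)
    finally have "quad_form (edge_set G) (adj ?L) y = - 2" .
    moreover have "(\<Sum>h\<in>edge_set G. (y h)\<^sup>2) = 2"
      unfolding power2_eq_square y using ef by (simp add: y_def)
    ultimately show ?thesis using bound[of y] by simp
  qed
  obtain x where x: "\<And>e. e \<in> edge_set G \<Longrightarrow> 0 < x e" "\<And>e. e \<in> edge_set G \<Longrightarrow>
      (\<Sum>f\<in>edge_set G. adj ?L e f * x f) = lambda_max ?L * x e"
    using line_graph_perron[OF conn ne] by blast
  have "\<exists>k c. proper_coloring ?L k c"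
    using fin by (rule finite_graph_colorable) simp_all
  then have "\<exists>c. proper_coloring ?L (chromatic_number ?L) c"
    unfolding chromatic_number_def by (rule LeastI_ex)
  then obtain c where c: "proper_coloring ?L (chromatic_number ?L) c" by blast
  have "real (chromatic_number ?L) = 1 - lambda_max ?L / lambda_min ?L"
    using hoff by (simp add: hoffman_colorable_def)
  then have max: "lambda_max ?L = (real (chromatic_number ?L) - 1) * - lambda_min ?L"
    using le by (simp add: field_simps)
  interpret hoffman_edge_coloring G c x "chromatic_number ?L" "- lambda_min ?L"
    using conn two c x max bound ge le by unfold_locales simp_all
  show ?thesis by (rule hoffman_classification)
qed

subsection \<open>The converse\<close>

text \<open>The pairwise intersecting edges in \<open>K\<close> form a clique of size
  \<open>k\<close> in the line graph, so \<open>k\<close> colors are optimal and only the eigenvalue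
  quotient has to be computed.\<close>

lemma hoffman_colorable_line_graphI:
  assumes conn: "Digraph_Component.connected (with_proj G)" and two: "2 \<le> card (edge_set G)"
    and c: "proper_coloring (line_graph G) k c"
    and K: "K \<subseteq> edge_set G" "card K = k" "\<And>e f. e \<in> K \<Longrightarrow> f \<in> K \<Longrightarrow> e \<inter> f \<noteq> {}"
    and k: "real k = 1 - lambda_max (line_graph G) / lambda_min (line_graph G)"
  shows "hoffman_colorable (line_graph G)"
  unfolding hoffman_colorable_def
proof (intro conjI)
  have ne: "edge_set G \<noteq> {}" using two by force
  show "pair_graph (line_graph G)" by (rule pair_graph_line_graph)
  show "Digraph_Component.connected (with_proj (line_graph G))"
    using conn ne by (rule connected_line_graph)
  obtain u v w where uvw: "{u, v} \<in> edge_set G" "{u, w} \<in> edge_set G" "u \<noteq> v" "u \<noteq> w" "v \<noteq> w"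
    using conn two by (rule adjacent_edges_exist)
  then have "({u, v}, {u, w}) \<in> parcs (line_graph G)" by (simp add: doubleton_eq_iff)
  then show "edge_set (line_graph G) \<noteq> {}" unfolding edge_set_def[of "line_graph G"] by blast
  have le: "k \<le> k'" if "proper_coloring (line_graph G) k' c'" for k' c'
    using clique_card_le[OF that, of K] K by auto
  have "chromatic_number (line_graph G) = k"
    unfolding chromatic_number_def
  proof (rule Least_equality)
    show "\<exists>c. proper_coloring (line_graph G) k c" using c by blast
    show "k \<le> k'" if "\<exists>c. proper_coloring (line_graph G) k' c" for k' using that le by (elim exE)
  qed
  then show "real (chromatic_number (line_graph G)) = 1 - lambda_max (line_graph G) / lambda_min (line_graph G)"
    using k by simp
qed

lemma line_graph_lambda_maxI:
  assumes "edge_set G \<noteq> {}" "\<And>e. e \<in> edge_set G \<Longrightarrow> 0 < x e"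
    and "\<And>e. e \<in> edge_set G \<Longrightarrow> (\<Sum>v\<in>e. vertex_sum G x v) - 2 * x e = m * x e"
  shows "lambda_max (line_graph G) = m"
  using assms by (intro lambda_max_eqI[where x = x]) (simp_all add: sum_adj_line_graph)

lemma proper_coloring_line_graphI:
  assumes "\<And>e. e \<in> edge_set G \<Longrightarrow> c e < k"
    and "\<And>e f. e \<in> edge_set G \<Longrightarrow> f \<in> edge_set G \<Longrightarrow> e \<inter> f \<noteq> {} \<Longrightarrow> c e = c f \<Longrightarrow> e = f"
  shows "proper_coloring (line_graph G) k c"
  unfolding proper_coloring_def
proof (intro conjI ballI)
  show "c e < k" if "e \<in> pverts (line_graph G)" for e using assms(1) that by simp
  fix a assume "a \<in> parcs (line_graph G)"
  moreover obtain e f where "a = (e, f)" by (cases a)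
  ultimately show "case a of (e, f) \<Rightarrow> c e \<noteq> c f" using assms(2)[of e f] by auto
qed

text \<open>With \<open>k\<close> factors the graph is \<open>k\<close>-regular, so the all-ones
  vector belongs to \<open>2 * k - 2\<close>. The difference of two factors has vertex sums 0 and
  belongs to -2, the least possible value. The clique consists of the edges at one vertex.\<close>

lemma one_factorable_imp_hoffman:
  assumes conn: "Digraph_Component.connected (with_proj G)" and two: "2 \<le> card (edge_set G)"
    and "one_factorable G"
  shows "hoffman_colorable (line_graph G)"
proof -
  obtain P where P: "partition_on (edge_set G) P" and factor: "\<And>M. M \<in> P \<Longrightarrow> one_factor G M"
    using assms(3) by (auto simp: one_factorable_def)
  have finP: "finite P" using finite_elements[OF finite_edge_set P] .
  have "\<forall>e\<in>edge_set G. \<exists>M\<in>P. e \<in> M" using partition_onD1[OF P] by blast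
  then obtain m where m: "\<And>e. e \<in> edge_set G \<Longrightarrow> m e \<in> P \<and> e \<in> m e" by metis
  have m_unique: "M = m e" if "M \<in> P" "e \<in> M" for e M
  proof -
    have "e \<in> edge_set G" using that partition_onD1[OF P] by blast
    then show ?thesis using disjointD[OF partition_onD2[OF P] that(1), of "m e"] m[of e] that(2) by blast
  qed
  have unique: "e = f" if "M \<in> P" "e \<in> M" "f \<in> M" "v \<in> e" "v \<in> f" "v \<in> pverts G" for M e f v
    using factor[OF that(1)] that(2-6) unfolding one_factor_def by blast
  have ind: "vertex_sum G (\<lambda>e. if e \<in> M then 1 else 0) v = 1" if M: "M \<in> P" and v: "v \<in> pverts G" for M v
  proof -
    have "M \<subseteq> edge_set G" "\<exists>!e. e \<in> M \<and> v \<in> e" using factor[OF M] v by (auto simp: one_factor_def)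
    then obtain e where e: "e \<in> M" "v \<in> e" "e \<in> edge_set G" by blast
    have "vertex_sum G (\<lambda>e. if e \<in> M then 1 else 0) v =
        (\<Sum>f\<in>{f \<in> edge_set G. v \<in> f}. if f = e then 1 else 0)"
      unfolding vertex_sum_def
    proof (rule sum.cong)
      fix f assume "f \<in> {f \<in> edge_set G. v \<in> f}"
      then have "f \<in> M \<longleftrightarrow> f = e" using unique[OF M e(1), of f v] e v by blast
      then show "(if f \<in> M then 1 else 0) = (if f = e then 1 else 0 :: real)" by simp
    qed simp
    also have "\<dots> = 1" using e by simp
    finally show ?thesis .
  qed
  define k where "k = card P"
  \<comment> \<open>Every edge lies in exactly one factor, so the degree is counted factor by
    factor, each contributing 1.\<close>
  have deg: "vertex_sum G (\<lambda>_. 1) v = real k" if v: "v \<in> pverts G" for v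
  proof -
    have "vertex_sum G (\<lambda>_. 1) v = (\<Sum>e\<in>{e \<in> edge_set G. v \<in> e}. \<Sum>M\<in>P. if e \<in> M then 1 else 0)"
      unfolding vertex_sum_def
    proof (rule sum.cong)
      fix e assume "e \<in> {e \<in> edge_set G. v \<in> e}"
      then have e: "m e \<in> P" "e \<in> m e" using m by auto
      have "(\<Sum>M\<in>P. if e \<in> M then 1 else 0) = (\<Sum>M\<in>P. if M = m e then 1 else 0 :: real)"
      proof (rule sum.cong)
        fix M assume "M \<in> P"
        then have "e \<in> M \<longleftrightarrow> M = m e" using m_unique e(2) by blast
        then show "(if e \<in> M then 1 else 0) = (if M = m e then 1 else 0 :: real)" by simp
      qed simp
      then show "1 = (\<Sum>M\<in>P. if e \<in> M then 1 else 0 :: real)" using e finP by simp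
    qed simp
    also have "\<dots> = (\<Sum>M\<in>P. vertex_sum G (\<lambda>e. if e \<in> M then 1 else 0) v)"
      unfolding vertex_sum_def by (rule sum.swap)
    also have "\<dots> = real k" using ind v by (simp add: k_def)
    finally show ?thesis .
  qed
  have ne: "edge_set G \<noteq> {}" using two by force
  obtain u v w where uvw: "{u, v} \<in> edge_set G" "{u, w} \<in> edge_set G" "u \<noteq> v" "u \<noteq> w" "v \<noteq> w"
    using conn two by (rule adjacent_edges_exist)
  have u: "u \<in> pverts G" using edge_subset[OF uvw(1)] by simp
  define e f where "e = {u, v}" and "f = {u, w}"
  have ef: "e \<in> edge_set G" "f \<in> edge_set G" "e \<noteq> f" using uvw by (auto simp: e_def f_def doubleton_eq_iff)
  \<comment> \<open>Adjacent edges lie in different factors, which provides the two factors for the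
    eigenvector \<open>z\<close>.\<close>
  have "m e \<noteq> m f" using unique[of "m e" e f u] m[OF ef(1)] m[OF ef(2)] ef(3) u by (auto simp: e_def f_def)
  have max: "lambda_max (line_graph G) = 2 * real k - 2"
  proof (rule line_graph_lambda_maxI[where x = "\<lambda>_. 1"])
    fix e assume "e \<in> edge_set G"
    then obtain a b where "e = {a, b}" "a \<noteq> b" "a \<in> pverts G" "b \<in> pverts G" by (rule edgeE)
    then show "(\<Sum>v\<in>e. vertex_sum G (\<lambda>_. 1) v) - 2 * 1 = (2 * real k - 2) * 1" using deg by simp
  qed (use ne in simp_all)
  define z :: "'a set \<Rightarrow> real"
    where "z = (\<lambda>h. (if h \<in> m e then 1 else 0) - (if h \<in> m f then 1 else 0))"
  have "e \<notin> m f" using m_unique[of "m f" e] m ef \<open>m e \<noteq> m f\<close> by blast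
  then have "z e \<noteq> 0" using m[OF ef(1)] by (simp add: z_def)
  have "vertex_sum G z v = 0" if "v \<in> pverts G" for v
  proof -
    have "vertex_sum G z v = vertex_sum G (\<lambda>h. if h \<in> m e then 1 else 0) v -
        vertex_sum G (\<lambda>h. if h \<in> m f then 1 else 0) v"
      by (simp add: vertex_sum_def z_def sum_subtractf)
    then show ?thesis using ind m ef that by simp
  qed
  then have "(\<Sum>v\<in>g. vertex_sum G z v) = 0" if "g \<in> edge_set G" for g
    using edge_subset[OF that] by (intro sum.neutral) blast
  then have "eigenpair (line_graph G) (- 2) z"
    using ef(1) \<open>z e \<noteq> 0\<close> by (auto simp: eigenpair_def sum_adj_line_graph)
  then have min: "lambda_min (line_graph G) = - 2"
    by (intro lambda_min_eqI) (simp_all add: line_graph_eigenvalue_ge)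
  obtain h where h: "bij_betw h P {0..<k}"
    using ex_bij_betw_finite_nat[OF finP] unfolding k_def by blast
  have coloring: "proper_coloring (line_graph G) k (\<lambda>e. h (m e))"
  proof (rule proper_coloring_line_graphI)
    show "h (m e) < k" if "e \<in> edge_set G" for e using bij_betwE[OF h] m[OF that] by simp
    show "e = f" if e: "e \<in> edge_set G" and f: "f \<in> edge_set G" and inter: "e \<inter> f \<noteq> {}" and eq: "h (m e) = h (m f)" for e f
    proof -
      obtain v where v: "v \<in> e" "v \<in> f" using inter by blast
      have "m e = m f" using inj_onD[OF bij_betw_imp_inj_on[OF h] eq] m[OF e] m[OF f] by blast
      then show ?thesis using unique[of "m e" e f v] m[OF e] m[OF f] v edge_subset[OF e] by auto
    qed
  qed
  show ?thesis
  proof (rule hoffman_colorable_line_graphI[OF conn two coloring])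
    show "card {e \<in> edge_set G. u \<in> e} = k" using deg[OF u] by (simp add: vertex_sum_def)
    show "real k = 1 - lambda_max (line_graph G) / lambda_min (line_graph G)"
      by (simp add: min max field_simps)
  qed auto
qed

text \<open>The line graph is complete, with adjacency matrix \<open>J - I\<close> for the all-ones
  matrix \<open>J\<close>. Its extreme eigenvalues are \<open>?m - 1\<close> and -1, and it needs
  \<open>?m\<close> colors.\<close>

lemma intersecting_edges_imp_hoffman:
  assumes conn: "Digraph_Component.connected (with_proj G)" and two: "2 \<le> card (edge_set G)"
    and inter: "\<And>e f. e \<in> edge_set G \<Longrightarrow> f \<in> edge_set G \<Longrightarrow> e \<inter> f \<noteq> {}"
  shows "hoffman_colorable (line_graph G)"
proof -
  let ?m = "card (edge_set G)"
  have ne: "edge_set G \<noteq> {}" using two by force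
  have sum: "(\<Sum>f\<in>edge_set G. adj (line_graph G) e f * z f) = (\<Sum>f\<in>edge_set G. z f) - z e"
    if e: "e \<in> edge_set G" for e z
  proof -
    have "(\<Sum>f\<in>edge_set G. adj (line_graph G) e f * z f) = (\<Sum>f\<in>edge_set G. z f - (if f = e then z f else 0))"
      using e inter by (intro sum.cong) (auto simp: adj_def)
    then show ?thesis using e by (simp add: sum_subtractf)
  qed
  have max: "lambda_max (line_graph G) = real ?m - 1"
    using ne by (intro lambda_max_eqI[where x = "\<lambda>_. 1"]) (simp_all add: sum[of _ "\<lambda>_. 1", simplified])
  obtain u v w where uvw: "{u, v} \<in> edge_set G" "{u, w} \<in> edge_set G" "u \<noteq> v" "u \<noteq> w" "v \<noteq> w"
    using conn two by (rule adjacent_edges_exist)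
  define e f where "e = {u, v}" and "f = {u, w}"
  have ef: "e \<in> edge_set G" "f \<in> edge_set G" "e \<noteq> f" using uvw by (auto simp: e_def f_def doubleton_eq_iff)
  define z :: "'a set \<Rightarrow> real" where "z = (\<lambda>h. (if h = e then 1 else 0) - (if h = f then 1 else 0))"
  have "(\<Sum>h\<in>edge_set G. z h) = 0" using ef by (simp add: z_def sum_subtractf)
  then have "eigenpair (line_graph G) (- 1) z"
    using ef by (auto simp: eigenpair_def sum z_def intro!: bexI[of _ e])
  moreover have "- 1 \<le> k" if y: "eigenpair (line_graph G) k y" for k y
  proof (rule quad_form_bound_imp_eigenvalue_bound[OF _ y])
    fix y
    have "quad_form (edge_set G) (adj (line_graph G)) y = (\<Sum>e\<in>edge_set G. y e * ((\<Sum>f\<in>edge_set G. y f) - y e))"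
      by (simp add: quad_form_def sum)
    also have "\<dots> = (\<Sum>f\<in>edge_set G. y f)\<^sup>2 - (\<Sum>e\<in>edge_set G. (y e)\<^sup>2)"
      by (simp add: right_diff_distrib sum_subtractf power2_eq_square flip: sum_distrib_right)
    finally show "- 1 * (\<Sum>v\<in>pverts (line_graph G). (y v)\<^sup>2) \<le> quad_form (pverts (line_graph G)) (adj (line_graph G)) y"
      by simp
  qed simp
  ultimately have min: "lambda_min (line_graph G) = - 1" by (intro lambda_min_eqI) simp_all
  obtain h where h: "bij_betw h (edge_set G) {0..<?m}"
    using ex_bij_betw_finite_nat[OF finite_edge_set] by blast
  have coloring: "proper_coloring (line_graph G) ?m h"
    using bij_betwE[OF h] inj_onD[OF bij_betw_imp_inj_on[OF h]] by (intro proper_coloring_line_graphI) simp_all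
  show ?thesis
  proof (rule hoffman_colorable_line_graphI[OF conn two coloring])
    show "e \<inter> f \<noteq> {}" if "e \<in> edge_set G" "f \<in> edge_set G" for e f using that by (rule inter)
  qed (simp_all add: min max)
qed

lemma star_imp_hoffman:
  assumes conn: "Digraph_Component.connected (with_proj G)" and two: "2 \<le> card (edge_set G)"
    and "complete_bipartite_digraph 1 m (with_proj G)"
  shows "hoffman_colorable (line_graph G)"
proof -
  obtain U V where U: "card U = 1" "parcs G = U \<times> V \<union> V \<times> U"
    using assms(3) unfolding complete_bipartite_digraph_pair_def by blast
  then obtain u where "U = {u}" by (auto simp: card_1_singleton_iff)
  then have "u \<in> e" if "e \<in> edge_set G" for e using that U(2) by (auto simp: edge_set_def)
  then show ?thesis by (intro intersecting_edges_imp_hoffman[OF conn two]) blast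
qed

text \<open>Two disjoint edges would need four vertices.\<close>

lemma triangle_imp_hoffman:
  assumes conn: "Digraph_Component.connected (with_proj G)" and two: "2 \<le> card (edge_set G)"
    and "complete_digraph 3 (with_proj G)"
  shows "hoffman_colorable (line_graph G)"
proof (rule intersecting_edges_imp_hoffman[OF conn two], rule notI)
  fix e f assume e: "e \<in> edge_set G" and f: "f \<in> edge_set G" and "e \<inter> f = {}"
  have "card e = 2" "card f = 2" using e f by (auto elim!: edgeE)
  then have "card (e \<union> f) = 4" using \<open>e \<inter> f = {}\<close> e f by (simp add: card_Un_disjoint finite_edge)
  moreover have "card (e \<union> f) \<le> card (pverts G)"
    using edge_subset[OF e] edge_subset[OF f] by (intro card_mono) simp_all
  ultimately show False using assms(3) unfolding complete_digraph_pair_def by simp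
qed

text \<open>The line graph is bipartite. Flipping the sign of the Perron vector on one color class
  gives an eigenvector for \<open>- lambda_max\<close>, the least value that
  \<open>abs_eigenvalue_le\<close> permits.\<close>

lemma two_edge_coloring_imp_hoffman:
  assumes conn: "Digraph_Component.connected (with_proj G)" and two: "2 \<le> card (edge_set G)"
    and c: "proper_coloring (line_graph G) 2 c"
  shows "hoffman_colorable (line_graph G)"
proof -
  let ?L = "line_graph G"
  have ne: "edge_set G \<noteq> {}" using two by force
  obtain x where pos: "\<And>e. e \<in> edge_set G \<Longrightarrow> 0 < x e" and eig: "\<And>e. e \<in> edge_set G \<Longrightarrow>
      (\<Sum>f\<in>edge_set G. adj ?L e f * x f) = lambda_max ?L * x e"
    using line_graph_perron[OF conn ne] by blast
  define s :: "'a set \<Rightarrow> real" where "s = (\<lambda>e. if c e = 0 then 1 else - 1)"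
  have s: "adj ?L e f * s f = adj ?L e f * - s e" if "e \<in> edge_set G" "f \<in> edge_set G" for e f
  proof (cases "(e, f) \<in> parcs ?L")
    case True
    then have "c e \<noteq> c f" using c unfolding proper_coloring_def by blast
    moreover have "c e < 2" "c f < 2" using c that by (simp_all add: proper_coloring_def)
    ultimately have "s f = - s e" by (auto simp: s_def)
    then show ?thesis by simp
  qed (simp add: adj_def del: line_graph_simps)
  have sx: "(\<Sum>f\<in>edge_set G. adj ?L e f * (s f * x f)) = - lambda_max ?L * (s e * x e)"
    if e: "e \<in> edge_set G" for e
  proof -
    have "(\<Sum>f\<in>edge_set G. adj ?L e f * (s f * x f)) = (\<Sum>f\<in>edge_set G. - s e * (adj ?L e f * x f))"
    proof (rule sum.cong)
      fix f assume "f \<in> edge_set G"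
      then have "adj ?L e f * s f * x f = adj ?L e f * - s e * x f" using s[OF e] by simp
      then show "adj ?L e f * (s f * x f) = - s e * (adj ?L e f * x f)" by (simp add: mult_ac)
    qed simp
    also have "\<dots> = - s e * (lambda_max ?L * x e)" unfolding sum_distrib_left[symmetric] eig[OF e] ..
    finally show ?thesis by simp
  qed
  obtain u v w where uvw: "{u, v} \<in> edge_set G" "{u, w} \<in> edge_set G" "u \<noteq> v" "u \<noteq> w" "v \<noteq> w"
    using conn two by (rule adjacent_edges_exist)
  define e f where "e = {u, v}" and "f = {u, w}"
  have ef: "e \<in> edge_set G" "f \<in> edge_set G" "e \<noteq> f" "e \<inter> f \<noteq> {}"
    using uvw by (auto simp: e_def f_def doubleton_eq_iff)
  have "s e * x e \<noteq> 0" using pos[OF ef(1)] by (simp add: s_def)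
  then have "eigenpair ?L (- lambda_max ?L) (\<lambda>e. s e * x e)"
    using ef(1) sx by (auto simp: eigenpair_def)
  moreover have "- lambda_max ?L \<le> k" if "eigenpair ?L k y" for k y
    using abs_eigenvalue_le[of ?L x "lambda_max ?L" k y] pos eig that by simp
  ultimately have min: "lambda_min ?L = - lambda_max ?L" by (intro lambda_min_eqI) simp_all
  \<comment> \<open>The quotient is -1 only for a nonzero eigenvalue, since division by 0 yields
    0.\<close>
  have "0 < adj ?L e f * x f" using ef pos by (simp add: adj_def)
  also have "\<dots> \<le> (\<Sum>h\<in>edge_set G. adj ?L e h * x h)"
    using ef pos by (intro member_le_sum) (auto simp: adj_def less_imp_le)
  also have "\<dots> = lambda_max ?L * x e" using ef eig by simp
  finally have nz: "lambda_max ?L \<noteq> 0" by auto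
  show ?thesis
  proof (rule hoffman_colorable_line_graphI[OF conn two c])
    show "{e, f} \<subseteq> edge_set G" "card {e, f} = 2" using ef by simp_all
    show "a \<inter> b \<noteq> {}" if "a \<in> {e, f}" "b \<in> {e, f}" for a b
      using that ef(4) by (auto simp: e_def f_def)
    show "real 2 = 1 - lambda_max ?L / lambda_min ?L" using nz min by simp
  qed
qed

lemma path_imp_hoffman:
  assumes conn: "Digraph_Component.connected (with_proj G)" and two: "2 \<le> card (edge_set G)"
    and "digraph_iso (with_proj G) (with_proj (path_graph n))"
  shows "hoffman_colorable (line_graph G)"
proof -
  obtain p where p: "inj_on p (pverts (path_graph n))" "parcs G = map_prod p p ` parcs (path_graph n)"
    using digraph_isoD[OF pair_wf_digraph assms(3)] by metis
  have inj: "inj_on p {..<n}" using p(1) by (simp add: path_graph_def)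
  have E: "\<exists>i. Suc i < n \<and> e = p ` {i, Suc i}" if e: "e \<in> edge_set G" for e
  proof -
    obtain e' where e': "e' \<in> edge_set (path_graph n)" "e = p ` e'"
      using e edge_set_image[OF p(2)] by blast
    then obtain i where "Suc i < n" "e' = {i, Suc i}"
      by (auto simp: edge_set_def path_graph_def insert_commute)
    then show ?thesis using e'(2) by blast
  qed
  define q where "q = the_inv_into {..<n} p"
  \<comment> \<open>The smaller label of an edge is its position on the path, and the parity of the
    position is the color.\<close>
  define c where "c = (\<lambda>e. Min (q ` e) mod 2)"
  have c: "c (p ` {i, Suc i}) = i mod 2" if "Suc i < n" for i
  proof -
    have "q (p i) = i" "q (p (Suc i)) = Suc i"
      using the_inv_into_f_f[OF inj, of i] the_inv_into_f_f[OF inj, of "Suc i"] that by (simp_all add: q_def)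
    then show ?thesis by (simp add: c_def)
  qed
  have "proper_coloring (line_graph G) 2 c"
  proof (rule proper_coloring_line_graphI)
    show "c e < 2" for e by (simp add: c_def)
    fix e f assume e: "e \<in> edge_set G" and f: "f \<in> edge_set G" and inter: "e \<inter> f \<noteq> {}" and eq: "c e = c f"
    obtain i where i: "Suc i < n" "e = p ` {i, Suc i}" using E[OF e] by blast
    obtain j where j: "Suc j < n" "f = p ` {j, Suc j}" using E[OF f] by blast
    have "p ` ({i, Suc i} \<inter> {j, Suc j}) = e \<inter> f"
      unfolding i(2) j(2) by (rule inj_on_image_Int[OF inj]) (use i(1) j(1) in auto)
    then have "{i, Suc i} \<inter> {j, Suc j} \<noteq> {}" using inter by auto
    then have "i = j \<or> i = Suc j \<or> j = Suc i" by auto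
    moreover have "i mod 2 = j mod 2" using eq i j c by simp
    ultimately have "i = j" by (auto simp: mod_Suc split: if_splits)
    then show "e = f" using i j by simp
  qed
  then show ?thesis by (rule two_edge_coloring_imp_hoffman[OF conn two])
qed

end

section \<open>The net\<close>

text \<open>
  In terms of \<open>y\<^sub>i\<close> on the triangle and \<open>l\<^sub>i\<close> on the pendant edges of the net, this expression is
  the form of \<open>A + \<phi> I\<close> for the golden ratio \<open>\<phi>\<close>, written with the vertex sums.
\<close>
lemma net_quad_form_nonneg:
  fixes \<phi> :: real
  assumes \<phi>: "\<phi> * \<phi> = \<phi> + 1" "\<phi> \<le> 2" "0 \<le> \<phi>"
  shows "0 \<le> (y1 + y3 + l0)\<^sup>2 + (y1 + y2 + l1)\<^sup>2 + (y2 + y3 + l2)\<^sup>2 + l0\<^sup>2 + l1\<^sup>2 + l2\<^sup>2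
    - (2 - \<phi>) * (y1\<^sup>2 + y2\<^sup>2 + y3\<^sup>2 + l0\<^sup>2 + l1\<^sup>2 + l2\<^sup>2)" (is "0 \<le> ?L")
proof -
  \<comment> \<open>Complete the square in each of \<open>l0\<close>, \<open>l1\<close>,
    \<open>l2\<close>, using that the inverse of \<open>\<phi>\<close> is \<open>\<phi> - 1\<close>.
    The rest is \<open>2 - \<phi>\<close> times the squares of the pair sums minus the squares of
    the \<open>y\<close> variables, which combine to the square of
    \<open>y1 + y2 + y3\<close>.\<close>
  have "?L = \<phi> * ((l0 + (\<phi> - 1) * (y1 + y3))\<^sup>2 + (l1 + (\<phi> - 1) * (y1 + y2))\<^sup>2 + (l2 + (\<phi> - 1) * (y2 + y3))\<^sup>2)
    + (2 - \<phi>) * (y1 + y2 + y3)\<^sup>2"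
  proof -
    have \<phi>': "\<phi> * (\<phi> - 1) = 1" using \<phi>(1) by (simp add: algebra_simps)
    have sq: "\<phi> * (l + (\<phi> - 1) * u)\<^sup>2 = \<phi> * l\<^sup>2 + 2 * l * u + (\<phi> - 1) * u\<^sup>2" for l u
    proof -
      have "\<phi> * (l + (\<phi> - 1) * u)\<^sup>2 =
          \<phi> * l\<^sup>2 + 2 * (\<phi> * (\<phi> - 1)) * l * u + (\<phi> * (\<phi> - 1)) * (\<phi> - 1) * u\<^sup>2"
        by (simp add: power2_eq_square algebra_simps)
      then show ?thesis unfolding \<phi>' by simp
    qed
    show ?thesis unfolding distrib_left[of \<phi>] sq by (simp add: power2_eq_square algebra_simps)
  qed
  moreover have "0 \<le> \<dots>" using \<phi>(2,3) by (intro add_nonneg_nonneg mult_nonneg_nonneg) simp_all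
  ultimately show ?thesis by simp
qed

text \<open>The extreme eigenvalues of the line graph are \<open>2 * \<phi>\<close> and
  \<open>- \<phi>\<close>, so the Hoffman bound is 3; the triangle edges form the clique.\<close>

lemma (in pair_graph) net_imp_hoffman:
  assumes conn: "Digraph_Component.connected (with_proj G)"
    and "digraph_iso (with_proj G) (with_proj net_graph)"
  shows "hoffman_colorable (line_graph G)"
proof -
  obtain p where p: "inj_on p (pverts net_graph)" "pverts G = p ` pverts net_graph"
    "parcs G = map_prod p p ` parcs net_graph"
    using digraph_isoD[OF pair_wf_digraph assms(2)] by metis
  define a0 a1 a2 a3 a4 a5
    where a: "a0 = p 0" "a1 = p 1" "a2 = p 2" "a3 = p 3" "a4 = p 4" "a5 = p 5"
  have dist: "distinct [a0, a1, a2, a3, a4, a5]"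
    using p(1) by (auto simp: a pverts_net_graph dest: inj_onD)
  \<comment> \<open>Both orders of the list give the simplifier each inequality in both
    directions.\<close>
  then have ne: "distinct [a0, a1, a2, a3, a4, a5]" "distinct [a5, a4, a3, a2, a1, a0]" by auto
  have V: "pverts G = {a0, a1, a2, a3, a4, a5}" unfolding p(2) pverts_net_graph a by simp
  define t0 t1 t2 l0 l1 l2 where e: "t0 = {a0, a1}" "t1 = {a1, a2}" "t2 = {a2, a0}"
    "l0 = {a0, a3}" "l1 = {a1, a4}" "l2 = {a2, a5}"
  have E: "edge_set G = {t0, t1, t2, l0, l1, l2}"
    unfolding edge_set_image[OF p(3)] edge_set_net_graph e a image_insert image_empty ..
  have d: "distinct [t0, t1, t2, l0, l1, l2]" "distinct [l2, l1, l0, t2, t1, t0]"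
    using ne by (simp_all add: e doubleton_eq_iff)
  have vs: "vertex_sum G z a0 = z t0 + z t2 + z l0" "vertex_sum G z a1 = z t0 + z t1 + z l1"
    "vertex_sum G z a2 = z t1 + z t2 + z l2" "vertex_sum G z a3 = z l0" "vertex_sum G z a4 = z l1"
    "vertex_sum G z a5 = z l2" for z
  proof -
    have *: "vertex_sum G z v = (\<Sum>e\<in>{t0, t1, t2, l0, l1, l2}. if v \<in> e then z e else 0)" for v
      unfolding vertex_sum_def E by (rule sum.inter_filter) simp
    have "vertex_sum G z v = (if v \<in> t0 then z t0 else 0) + (if v \<in> t1 then z t1 else 0) + (if v \<in> t2 then z t2 else 0)
      + (if v \<in> l0 then z l0 else 0) + (if v \<in> l1 then z l1 else 0) + (if v \<in> l2 then z l2 else 0)" for v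
      unfolding * using d by simp
    note vs = this
    show "vertex_sum G z a0 = z t0 + z t2 + z l0" unfolding vs using ne by (simp add: e)
    show "vertex_sum G z a1 = z t0 + z t1 + z l1" unfolding vs using ne by (simp add: e)
    show "vertex_sum G z a2 = z t1 + z t2 + z l2" unfolding vs using ne by (simp add: e)
    show "vertex_sum G z a3 = z l0" unfolding vs using ne by (simp add: e)
    show "vertex_sum G z a4 = z l1" unfolding vs using ne by (simp add: e)
    show "vertex_sum G z a5 = z l2" unfolding vs using ne by (simp add: e)
  qed
  have es: "(\<Sum>v\<in>t0. S v) = S a0 + S a1" "(\<Sum>v\<in>t1. S v) = S a1 + S a2" "(\<Sum>v\<in>t2. S v) = S a2 + S a0"
    "(\<Sum>v\<in>l0. S v) = S a0 + S a3" "(\<Sum>v\<in>l1. S v) = S a1 + S a4" "(\<Sum>v\<in>l2. S v) = S a2 + S a5"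
    for S :: "'a \<Rightarrow> real"
    using ne by (simp_all add: e)
  define \<phi> :: real where "\<phi> = (1 + sqrt 5) / 2"
  have "sqrt 5 * sqrt 5 = (5 :: real)" "1 \<le> sqrt (5 :: real)" "sqrt (5 :: real) \<le> 3"
    by (simp_all add: real_le_lsqrt)
  then have \<phi>: "\<phi> * \<phi> = \<phi> + 1" "1 \<le> \<phi>" "\<phi> \<le> 2" by (simp_all add: \<phi>_def field_simps)
  define x :: "'a set \<Rightarrow> real" where "x = (\<lambda>s. if s \<in> {t0, t1, t2} then \<phi> else 1)"
  have x: "x t0 = \<phi>" "x t1 = \<phi>" "x t2 = \<phi>" "x l0 = 1" "x l1 = 1" "x l2 = 1"
    using d by (simp_all add: x_def)
  have max: "lambda_max (line_graph G) = 2 * \<phi>"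
  proof (rule line_graph_lambda_maxI[where x = x])
    show "0 < x s" for s using \<phi>(2) by (simp add: x_def)
    show "(\<Sum>v\<in>s. vertex_sum G x v) - 2 * x s = 2 * \<phi> * x s" if "s \<in> edge_set G" for s
      using that unfolding E
      by (elim insertE emptyE) (simp_all add: es vs x \<phi>(1) mult.assoc)
  qed (simp add: E)
  \<comment> \<open>All squares behind \<open>net_quad_form_nonneg\<close> vanish here: the triangle
    entries add up to 0, and each pendant entry is \<open>- (\<phi> - 1)\<close> times the sum of
    the two adjacent triangle entries.\<close>
  define z :: "'a set \<Rightarrow> real" where "z = (\<lambda>s. if s = t0 then \<phi> else if s = t1 then - \<phi> else
    if s = l0 then - 1 else if s = l2 then 1 else 0)"
  have z: "z t0 = \<phi>" "z t1 = - \<phi>" "z t2 = 0" "z l0 = - 1" "z l1 = 0" "z l2 = 1"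
    using d by (simp_all add: z_def)
  have eig: "(\<Sum>v\<in>s. vertex_sum G z v) - 2 * z s = - \<phi> * z s" if "s \<in> edge_set G" for s
    using that unfolding E by (elim insertE emptyE) (simp_all add: es vs z \<phi>(1))
  have "t0 \<in> edge_set G" "z t0 \<noteq> 0" using z(1) \<phi>(2) by (simp_all add: E)
  then have ev: "eigenpair (line_graph G) (- \<phi>) z"
    using eig unfolding eigenpair_def line_graph_simps
    by (intro conjI bexI[of _ t0] ballI) (simp_all add: sum_adj_line_graph)
  have bound: "- \<phi> * (\<Sum>s\<in>edge_set G. (y s)\<^sup>2) \<le> quad_form (edge_set G) (adj (line_graph G)) y" for y
  proof -
    have "(\<Sum>v\<in>pverts G. (vertex_sum G y v)\<^sup>2) = (y t0 + y t2 + y l0)\<^sup>2 + (y t0 + y t1 + y l1)\<^sup>2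
        + (y t1 + y t2 + y l2)\<^sup>2 + (y l0)\<^sup>2 + (y l1)\<^sup>2 + (y l2)\<^sup>2"
      unfolding V using ne by (simp add: vs)
    moreover have "(\<Sum>s\<in>edge_set G. (y s)\<^sup>2) =
        (y t0)\<^sup>2 + (y t1)\<^sup>2 + (y t2)\<^sup>2 + (y l0)\<^sup>2 + (y l1)\<^sup>2 + (y l2)\<^sup>2"
      unfolding E using d by simp
    \<comment> \<open>The instances follow the order in which the variables first occur:
      \<open>y1\<close>, \<open>y3\<close>, \<open>l0\<close>, \<open>y2\<close>, \<open>l1\<close>,
      \<open>l2\<close>.\<close>
    ultimately show ?thesis
      using net_quad_form_nonneg[OF \<phi>(1,3), of "y t0" "y t2" "y l0" "y t1" "y l1" "y l2"] \<phi>(2)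
      unfolding quad_form_line_graph by (simp add: algebra_simps)
  qed
  have min: "lambda_min (line_graph G) = - \<phi>"
  proof (rule lambda_min_eqI[OF _ ev])
    show "- \<phi> \<le> k" if "eigenpair (line_graph G) k y" for k y
      using quad_form_bound_imp_eigenvalue_bound[of "line_graph G" k y "- \<phi>"] that bound by simp
  qed simp
  \<comment> \<open>Each triangle edge shares its color with the pendant edge at the opposite
    vertex.\<close>
  define c :: "'a set \<Rightarrow> nat" where "c = (\<lambda>s. if s \<in> {t0, l2} then 0 else if s \<in> {t1, l0} then 1 else 2)"
  have c: "c t0 = 0" "c t1 = 1" "c t2 = 2" "c l0 = 1" "c l1 = 2" "c l2 = 0"
    using d by (simp_all add: c_def)
  have disj: "t0 \<inter> l2 = {}" "t1 \<inter> l0 = {}" "t2 \<inter> l1 = {}"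
    "l2 \<inter> t0 = {}" "l0 \<inter> t1 = {}" "l1 \<inter> t2 = {}" using ne by (simp_all add: e)
  have coloring: "proper_coloring (line_graph G) 3 c"
  proof (rule proper_coloring_line_graphI)
    show "c s < 3" for s by (simp add: c_def)
    show "s = t" if "s \<in> edge_set G" "t \<in> edge_set G" "s \<inter> t \<noteq> {}" "c s = c t" for s t
      using that unfolding E
      by (elim insertE emptyE) (simp_all add: c disj)
  qed
  have "card {t0, t1, t2, l0, l1, l2} = 6" using d by simp
  then have two: "2 \<le> card (edge_set G)" unfolding E by simp
  show ?thesis
  proof (rule hoffman_colorable_line_graphI[OF conn two coloring])
    show "{t0, t1, t2} \<subseteq> edge_set G" unfolding E by blast
    show "card {t0, t1, t2} = 3" using d by simp
    show "s \<inter> t \<noteq> {}" if "s \<in> {t0, t1, t2}" "t \<in> {t0, t1, t2}" for s t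
      using that by (elim insertE emptyE) (simp_all add: e)
    show "real 3 = 1 - lambda_max (line_graph G) / lambda_min (line_graph G)"
      using \<phi>(2) by (simp add: max min)
  qed
qed

theorem theorem3p12:
  fixes G :: "'a pair_pre_digraph"
  assumes "pair_graph G"
    and "Digraph_Component.connected (with_proj G)"
    and "card (edge_set G) \<ge> 2"
  shows "hoffman_colorable (line_graph G) \<longleftrightarrow>
      one_factorable G \<or>
      (\<exists>m. complete_bipartite_digraph 1 m (with_proj G)) \<or>
      (\<exists>n. digraph_iso (with_proj G) (with_proj (path_graph n))) \<or>
      complete_digraph 3 (with_proj G) \<or>
      digraph_iso (with_proj G) (with_proj net_graph)"
proof -
  interpret pair_graph G by fact
  note G = assms(2,3)
  show ?thesis
    using hoffman_colorable_line_graph_imp[OF G] one_factorable_imp_hoffman[OF G] star_imp_hoffman[OF G]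
      path_imp_hoffman[OF G] triangle_imp_hoffman[OF G] net_imp_hoffman[OF G(1)]
    by blast
qed

end
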